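(* Consider the polynomial-filtered proximal gradient (PFPG) iteration described in the context, and suppose that Assumption A and Assumption B of the context hold. Let $L$ be the Lipschitz constant of $\nabla F$, let $\tau_k=\tau\le\frac1L$, and let $\bar x^K=\frac1K\sum_{k=1}^Kx^k$. Then the convergence $\lim_{K\to\infty}h(\bar x^K)=h(x^* )$ holds, where $x^*$ is an optimal solution of $\min_x h(x)$, if $$d_k=\Omega\left(\frac{\log k}{\min\{l,1\}}\right).$$
   Context: Problem. Minimize $h(x)=F(x)+R(x)$ over $x\in\mathbb{R}^m$, where $F(x)=f(\lambda(\mathcal{B}(x)))$, $\mathcal{B}(x)=G+\mathcal{A}^*(x)$, $G\in\mathcal{S}^n$ (real symmetric $n\times n$ matrices) is known, $\mathcal{A}^*:\mathbb{R}^m\to\mathcal{S}^n$ is a linear operator with adjoint $\mathcal{A}$, $\lambda(X)$ is the vector of eigenvalues $\lambda_1\ge\dots\ge\lambda_n$ of $X$, $f:\mathbb{R}^n\to\mathbb{R}$ is smooth with $f(y)=f(Py)$ for every permutation matrix $P$, and $R$ is a regularizer that need not be smooth. $F$ and $R$ are convex, and $\nabla F$ is Lipschitz continuous. $\mathrm{prox}_{tR}(x)=\arg\min_u R(u)+\frac1{2t}\|u-x\|_2^2$. For a matrix $S$ with orthonormal columns, $\mathcal{P}_S(X)=SS^TXSS^T$. A spectral operator is a map $V\mathrm{Diag}(\mu)V^T\mapsto V\mathrm{Diag}(\phi(\mu))V^T$, $V$ orthogonal, acting on the eigenvalues of a symmetric matrix. PFPG. With step sizes $\tau_k$, $$x^{k+1}=\mathrm{prox}_{\tau_kR}\big(x^k-\tau_k\mathcal{A}(\Phi(\mathcal{P}_{U^k}(\mathcal{B}(x^k))))\big),\qquad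 U^{k+1}=\mathrm{orth}\big(\rho_{k+1}^{q_{k+1}}(\mathcal{B}(x^{k+1}))U^k\big),$$ where $U^k\in\mathbb{R}^{n\times p}$ has orthonormal columns, $p\ge|\mathcal{I}_k|$ ($\mathcal I_k$ below), $\mathrm{orth}$ denotes orthogonalization of the columns, $q_k\ge1$ is a small integer (the filter is applied $q_k$ times), and $\rho_k(t)=T_{d_k}\big(\frac{t-(b_k+a_k)/2}{(b_k-a_k)/2}\big)$ with $T_d$ the Chebyshev polynomial of the first kind of degree $d$ and $[a_k,b_k]$ the interval suppressed at iteration $k$; $d_k$ is the degree of the filter at iteration $k$. Assumption A. (i) There is an index set $\mathcal{I}(x)=\{s,s+1,\dots,t\}\subset\{1,\dots,n\}$ such that $\nabla F(x)=\mathcal{A}(\Phi(\mathcal{P}_{V_{\mathcal{I}}}(\mathcal{B}(x))))$, where $\Phi$ is a spectral operator and $V_{\mathcal{I}}\in\mathbb{R}^{n\times|\mathcal I|}$ contains the (orthonormal) eigenvectors $v_i$, $i\in\mathcal{I}(x)$, of $\mathcal{B}(x)$. (ii) $\|\Phi(X)-\Phi(Y)\|_F\le L_\Phi\|X-Y\|_F$. Write $\mathcal{I}_k=\mathcal{I}(x^k)$ and $V^k_{\mathcal{I}_k}$ for the corresponding eigenvector matrix of $\mathcal{B}(x^k)$; $\mathcal{I}_k$ is the index set of the eigenvalues $\lambda_i$ of $\mathcal{B}(x^k)$ outside $[a_k,b_k]$. The relative gap is $$\mathcal{G}_k=\min_{i\in\mathcal{I}_k}\Big(\frac{|\lambda_i-(a_k+b_k)/2|}{(b_k-a_k)/2}-1\Big).$$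 For matrices $X,Y$ with orthonormal columns, $\Theta(X,Y)$ is the diagonal matrix with diagonal entries $\arccos\sigma_j$, where $\sigma_1\ge\sigma_2\ge\cdots$ are the singular values of $X^TY$ (if the numbers of columns differ, as many singular values as the smaller number); $\sin\Theta$ is taken componentwise. Assumption B. (i) $\|\sin\Theta(V^{k+1}_{\mathcal{I}_{k+1}},U^k)\|_2<\gamma$ for all $k$, with $\gamma<1$. (ii) $\|x^k\|_2\le M$ for all $k$, for some constant $M$. (iii) $\mathcal{G}_k\ge l$ for all $k$, with $l>0$.
   Formalization: When p > |I_k| the claim fails as stated, so it is additionally assumed there that for every S with p orthonormal columns whose span contains the v_i, i in I_k, A(Φ(P_S(B(x^k)))) equals the gradient of F at x^k; nothing is added when p = |I_k|. *)

theory Defs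
  imports
    "HOL-Analysis.Analysis"
    "HOL-Computational_Algebra.Polynomial"
    "HOL-Library.Landau_Symbols"
begin

text \<open>Matrices with a rows and b columns have type \<^typ>\<open>real^'b^'a\<close>; the library norm and inner
  product on this type are the Frobenius norm and the trace inner product.  Index types that
  carry ordered data (eigenvalues, singular values) are finite linear orders, in place of
  1, ..., n.\<close>

subsection \<open>Eigenvalues, spectral operators, singular values\<close>

definition Diag :: "real^'n \<Rightarrow> real^'n^'n" where
  "Diag d = (\<chi> i j. if i = j then d $ i else 0)"

definition eigen_decomp ::
    "real^'n::{finite,linorder}^'n::{finite,linorder} \<Rightarrow> real^'n::{finite,linorder}^'n::{finite,linorder}
     \<Rightarrow> real^'n::{finite,linorder} \<Rightarrow> bool" where
  "eigen_decomp X V l \<longleftrightarrow>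
     orthogonal_matrix V \<and> (\<forall>i j. i \<le> j \<longrightarrow> l $ j \<le> l $ i) \<and> X = V ** Diag l ** transpose V"

text \<open>Eigenvalues with multiplicity in decreasing order; meaningful for symmetric matrices only.\<close>

definition eigvals :: "real^'n::{finite,linorder}^'n::{finite,linorder} \<Rightarrow> real^'n::{finite,linorder}" where
  "eigvals X = (THE l. \<exists>V. eigen_decomp X V l)"

definition spectral_operator :: "(real^'n^'n \<Rightarrow> real^'n^'n) \<Rightarrow> bool" where
  "spectral_operator \<Phi> \<longleftrightarrow>
     (\<exists>\<phi>. \<forall>V \<mu>. orthogonal_matrix V \<longrightarrow>
        \<Phi> (V ** Diag \<mu> ** transpose V) = V ** Diag (\<phi> \<mu>) ** transpose V)"

text \<open>One entry per column, so for a matrix with fewer rows than columns the singular values are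
  followed by surplus zeros.\<close>

definition sing_vals :: "real^'b::{finite,linorder}^'a \<Rightarrow> real^'b::{finite,linorder}" where
  "sing_vals M = (\<chi> j. sqrt (eigvals (transpose M ** M) $ j))"

subsection \<open>Matrices with orthonormal columns\<close>

definition orthonormal_cols :: "real^'p^'n \<Rightarrow> bool" where
  "orthonormal_cols S \<longleftrightarrow> transpose S ** S = mat 1"

text \<open>The number of columns of the eigenvector matrix for an index set varies with the set and so
  cannot be a type.  The matrix is kept square, with the columns outside the set replaced by
  zero; these contribute nothing to the products formed below.\<close>

definition sub_cols :: "real^'n^'n \<Rightarrow> 'n set \<Rightarrow> real^'n^'n" where
  "sub_cols V I = (\<chi> a i. if i \<in> I then V $ a $ i else 0)"

definition Proj :: "real^'p^'n \<Rightarrow> real^'n^'n \<Rightarrow> real^'n^'n" where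
  "Proj S X = S ** transpose S ** X ** S ** transpose S"

text \<open>The principal angles between the columns of V with index in I and the columns of U.
  There are as many as the smaller number of columns; the remaining diagonal entries, caused
  only by the zero padding, are set to 0.  The condition below selects the first
  \<open>min (card I) CARD('p)\<close> positions.\<close>

definition Theta ::
    "real^'n^'n \<Rightarrow> 'n set \<Rightarrow> real^'p::{finite,linorder}^'n
     \<Rightarrow> real^'p::{finite,linorder}^'p::{finite,linorder}" where
  "Theta V I U =
     Diag (\<chi> j. if card {..<j} < card I
               then arccos (sing_vals (transpose (sub_cols V I) ** U) $ j) else 0)"

definition sin_mat :: "real^'b^'a \<Rightarrow> real^'b^'a" where
  "sin_mat A = (\<chi> i j. sin (A $ i $ j))"

definition spectral_norm :: "real^'b^'a \<Rightarrow> real" where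
  "spectral_norm A = onorm (\<lambda>v. A *v v)"

text \<open>Q is a result of orthogonalizing the columns of M (Gram-Schmidt, QR, polar factor, ...).
  If M has full column rank, T is invertible and the column spaces coincide.\<close>

definition is_orth :: "real^'p^'n \<Rightarrow> real^'p^'n \<Rightarrow> bool" where
  "is_orth Q M \<longleftrightarrow> orthonormal_cols Q \<and> (\<exists>T::real^'p^'p. M = Q ** T)"

subsection \<open>Chebyshev filters\<close>

fun cheb :: "nat \<Rightarrow> real poly" where
  "cheb 0 = 1"
| "cheb (Suc 0) = [:0, 1:]"
| "cheb (Suc (Suc d)) = [:0, 2:] * cheb (Suc d) - cheb d"

definition cheb_filter :: "nat \<Rightarrow> real \<Rightarrow> real \<Rightarrow> real poly" where
  "cheb_filter d a b =
     pcompose (cheb d) [: - ((b + a) / 2) / ((b - a) / 2), 1 / ((b - a) / 2) :]"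

text \<open>Powers on the type of square matrices are componentwise, hence the iterated product.\<close>

definition poly_mat :: "real poly \<Rightarrow> real^'n^'n \<Rightarrow> real^'n^'n" where
  "poly_mat p A = (\<Sum>i\<le>degree p. coeff p i *\<^sub>R (((**) A ^^ i) (mat 1)))"

text \<open>A minimum over the index set; the value is infinite when the set is empty.\<close>

definition rel_gap :: "real^'n \<Rightarrow> 'n set \<Rightarrow> real \<Rightarrow> real \<Rightarrow> ereal" where
  "rel_gap l I a b = (INF i\<in>I. ereal (\<bar>l $ i - (a + b) / 2\<bar> / ((b - a) / 2) - 1))"

subsection \<open>Extended-valued convex functions and the proximal map\<close>

definition ereal_convex :: "('a::real_vector \<Rightarrow> ereal) \<Rightarrow> bool" where
  "ereal_convex R \<longleftrightarrow> (\<forall>x. R x \<noteq> -\<infinity>) \<and>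
     (\<forall>x y. \<forall>t\<in>{0..1}.
        R ((1 - t) *\<^sub>R x + t *\<^sub>R y) \<le> ereal (1 - t) * R x + ereal t * R y)"

text \<open>u is (the) proximal point of x.  A relation, since without lower semicontinuity a minimizer
  need not exist.\<close>

definition is_prox :: "real \<Rightarrow> ('a::real_normed_vector \<Rightarrow> ereal) \<Rightarrow> 'a \<Rightarrow> 'a \<Rightarrow> bool" where
  "is_prox t R x u \<longleftrightarrow>
     is_arg_min (\<lambda>w. R w + ereal (1 / (2 * t) * (norm (w - x))\<^sup>2)) (\<lambda>_. True) u"

end

theory Submission
  imports Defs
begin

text \<open>Filtering multiplies the wanted eigencomponents of B(x) by at least 1 + d l in absolute value,
  since the Chebyshev polynomial of degree d is at least 1 + d (t - 1) for t \<ge> 1, and the other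
  components by at most 1.  The angle bound therefore gives every wanted eigenvector of the current
  matrix a distance O(1 / (1 + d l)) from the range of U.  Replacing the part of the range of U
  closest to the wanted eigenspace by that eigenspace yields S with a nearby projection, for which
  the reduced gradient is the exact gradient.  As \<Phi> is Lipschitz and the iterates are bounded,
  the gradient error at step k is O(1 / d(k)), hence tends to 0.

  The inexact proximal gradient inequality, summed and combined with Jensen's inequality, bounds
  the suboptimality of the average by O(1/K) plus a constant times the Cesaro mean of the gradient
  errors; so no rate is needed, only that d(k) tends to infinity.\<close>

declare transpose_matrix_vector [simp del]

subsection \<open>Matrices acting on vectors\<close>

lemma inner_matrix_vector_left: "(A *v x) \<bullet> y = x \<bullet> (transpose A *v (y :: real^'n))"
  by (metis dot_lmul_matrix vector_transpose_matrix inner_commute)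

lemma Diag_mult_vec: "Diag d *v z = (\<chi> i. d $ i * z $ i)"
  by (simp add: Diag_def matrix_vector_mult_def vec_eq_iff if_distrib [of "\<lambda>x. x * _"] sum.delta
      cong: if_cong)

lemma inner_Diag: "z \<bullet> (Diag d *v z) = (\<Sum>i\<in>UNIV. d $ i * (z $ i)\<^sup>2)"
  by (simp add: Diag_mult_vec inner_vec_def power2_eq_square mult_ac)

lemma norm_sq_cart: "(norm z)\<^sup>2 = (\<Sum>i\<in>UNIV. (z $ i)\<^sup>2)" for z :: "real^'n"
  unfolding power2_norm_eq_inner inner_vec_def by (simp add: power2_eq_square)

lemma orthonormal_cols_inner:
  assumes "orthonormal_cols Q"
  shows "(Q *v x) \<bullet> (Q *v y) = x \<bullet> y"
  using assms
  by (simp add: inner_matrix_vector_left matrix_vector_mul_assoc orthonormal_cols_def)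

lemma orthonormal_cols_norm:
  assumes "orthonormal_cols Q"
  shows "norm (Q *v x) = norm x"
  by (simp add: norm_eq_sqrt_inner orthonormal_cols_inner [OF assms])

lemma orthonormal_cols_iff:
  "orthonormal_cols Q \<longleftrightarrow> (\<forall>i j. column i Q \<bullet> column j Q = (if i = j then 1 else 0))"
  by (auto simp: orthonormal_cols_def vec_eq_iff matrix_matrix_mult_def transpose_def mat_def
      column_def inner_vec_def)

lemma orthogonal_matrix_cols: "orthogonal_matrix V \<Longrightarrow> orthonormal_cols V"
  by (simp add: orthogonal_matrix_def orthonormal_cols_def)

lemma orthogonal_matrix_transpose_cols: "orthogonal_matrix V \<Longrightarrow> orthonormal_cols (transpose V)"
  by (simp add: orthogonal_matrix_def orthonormal_cols_def)

lemma orthogonal_matrix_cancel: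
  assumes "orthogonal_matrix V"
  shows "V *v (transpose V *v x) = x" "transpose V *v (V *v x) = x"
  using assms by (simp_all add: matrix_vector_mul_assoc orthogonal_matrix_def)

lemma column_eq_mult_axis: "column i V = V *v axis i 1"
  by (simp add: vec_eq_iff column_def matrix_vector_mult_def axis_def if_distrib [of "\<lambda>x. _ * x"]
      sum.delta' cong: if_cong)

lemma dim_supported: "dim {x :: real^'n. \<forall>i. i \<notin> d \<longrightarrow> x $ i = 0} = card d"
  using dim_substandard_cart [of d, where 'a = real] by (simp add: dim_vec_eq)

lemma subspace_supported: "subspace {x :: real^'n. \<forall>i. i \<notin> d \<longrightarrow> x $ i = 0}"
  by (auto simp: subspace_def)

lemma dim_image_supported:
  assumes "orthogonal_matrix V"
  shows "dim ((*v) V ` {x :: real^'n. \<forall>i. i \<notin> d \<longrightarrow> x $ i = 0}) = card d"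
proof -
  have "inj_on ((*v) V) (span {x :: real^'n. \<forall>i. i \<notin> d \<longrightarrow> x $ i = 0})"
    by (rule inj_on_inverseI [of _ "(*v) (transpose V)"])
      (rule orthogonal_matrix_cancel [OF assms])
  then have "dim ((*v) V ` {x :: real^'n. \<forall>i. i \<notin> d \<longrightarrow> x $ i = 0}) =
      dim {x :: real^'n. \<forall>i. i \<notin> d \<longrightarrow> x $ i = 0}"
    by (intro dim_image_eq) auto
  then show ?thesis
    by (simp add: dim_supported)
qed

subsection \<open>Spectral theorem\<close>

lemma rayleigh_maximizer:
  fixes A :: "real^'n^'n"
  assumes sym: "transpose A = A" and J: "finite J" "card J < CARD('n)"
    and eig: "\<And>j. j \<in> J \<Longrightarrow> A *v v j = l j *\<^sub>R v j"
  shows "\<exists>u m. norm u = 1 \<and> (\<forall>j\<in>J. u \<bullet> v j = 0) \<and> A *v u = m *\<^sub>R u \<and>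
    (\<forall>x. (\<forall>j\<in>J. x \<bullet> v j = 0) \<longrightarrow> x \<bullet> (A *v x) \<le> m * (norm x)\<^sup>2)"
proof -
  have symA: "(A *v x) \<bullet> y = x \<bullet> (A *v y)" for x y
    by (simp add: inner_matrix_vector_left sym)
  define W where "W = {x. \<forall>j\<in>J. x \<bullet> v j = 0}"
  have subW: "subspace W"
    by (auto simp: W_def subspace_def inner_add_left)
  have "dim (v ` J) \<le> card (v ` J)"
    by (rule dim_le_card') (use J in auto)
  also have "\<dots> < CARD('n)"
    using J card_image_le [of J v] by auto
  finally have "dim (v ` J) < DIM(real^'n)"
    by simp
  then obtain w where w: "w \<noteq> 0" "\<And>y. y \<in> span (v ` J) \<Longrightarrow> orthogonal w y"
    using orthogonal_to_subspace_exists by blast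
  have wW: "w \<in> W"
    using w(2) by (auto simp: W_def orthogonal_def intro: span_base)
  let ?C = "W \<inter> sphere 0 1"
  have "closed W"
    by (rule closed_subspace [OF subW])
  then have "compact ?C"
    by (intro closed_Int_compact) auto
  moreover have "w /\<^sub>R norm w \<in> ?C"
    using w wW subW by (auto simp: subspace_scale)
  moreover have "continuous_on ?C (\<lambda>x. x \<bullet> (A *v x))"
    by (intro continuous_intros)
  ultimately obtain u where u: "u \<in> ?C" "\<And>y. y \<in> ?C \<Longrightarrow> y \<bullet> (A *v y) \<le> u \<bullet> (A *v u)"
    using continuous_attains_sup [of ?C "\<lambda>x. x \<bullet> (A *v x)"] by blast
  define m where "m = u \<bullet> (A *v u)"
  have bound: "x \<bullet> (A *v x) \<le> m * (norm x)\<^sup>2" if "x \<in> W" for x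
  proof (cases "x = 0")
    case False
    then have "x /\<^sub>R norm x \<in> ?C"
      using that subW by (auto simp: subspace_scale)
    from u(2) [OF this] have "(x \<bullet> (A *v x)) / (norm x)\<^sup>2 \<le> m"
      by (simp add: m_def matrix_vector_mult_scaleR power2_eq_square field_simps)
    then show ?thesis
      using False by (simp add: field_simps)
  qed auto
  have AW: "A *v x \<in> W" if "x \<in> W" for x
    using that eig by (auto simp: W_def symA)
  define y where "y = A *v u - m *\<^sub>R u"
  have nu: "u \<bullet> u = 1" and uW: "u \<in> W"
    using u(1) by (auto simp: norm_eq_sqrt_inner)
  have yW: "y \<in> W"
    unfolding y_def using AW uW subW by (intro subspace_diff subspace_scale)
  have yu: "u \<bullet> y = 0"
    by (simp add: y_def inner_diff_right nu m_def)
  have yAu: "y \<bullet> (A *v u) = y \<bullet> y"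
    using yu by (simp add: y_def inner_diff_right inner_commute)
  define c where "c = y \<bullet> (A *v y) - m * (y \<bullet> y)"
  have quad: "2 * t * (y \<bullet> y) + t\<^sup>2 * c \<le> 0" for t :: real
  proof -
    have "u + t *\<^sub>R y \<in> W"
      using uW yW subW by (intro subspace_add subspace_scale)
    from bound [OF this]
    have "(u + t *\<^sub>R y) \<bullet> (A *v (u + t *\<^sub>R y)) \<le> m * ((u + t *\<^sub>R y) \<bullet> (u + t *\<^sub>R y))"
      by (simp add: power2_norm_eq_inner)
    then have "m + t * (u \<bullet> (A *v y)) + t * (y \<bullet> (A *v u)) + t * (t * (y \<bullet> (A *v y)))
        \<le> m * (1 + t * (t * (y \<bullet> y)))"
      using yu nu
      by (simp add: matrix_vector_right_distrib matrix_vector_mult_scaleR inner_add_left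
          inner_add_right m_def inner_commute [of y u] algebra_simps)
    moreover have "u \<bullet> (A *v y) = y \<bullet> (A *v u)"
      using symA [of u y] by (simp add: inner_commute)
    ultimately show ?thesis
      by (simp add: yAu c_def power2_eq_square algebra_simps)
  qed
  have "y \<bullet> y = 0"
  proof (rule ccontr)
    assume "y \<bullet> y \<noteq> 0"
    then have pos: "y \<bullet> y > 0"
      by (simp add: order_less_le)
    define t where "t = (y \<bullet> y) / (\<bar>c\<bar> + 1)"
    have t: "t > 0"
      using pos by (simp add: t_def add_nonneg_pos)
    have "2 * (y \<bullet> y) + t * c \<le> 0"
    proof -
      have "t * (2 * (y \<bullet> y) + t * c) \<le> 0"
        using quad [of t] by (simp add: power2_eq_square algebra_simps)
      then show ?thesis
        using t by (simp add: mult_le_0_iff)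
    qed
    moreover have "t * \<bar>c\<bar> \<le> y \<bullet> y"
      using pos by (simp add: t_def field_simps)
    moreover have "- (t * c) \<le> t * \<bar>c\<bar>"
      using t by (simp add: abs_if)
    ultimately show False
      using pos by linarith
  qed
  then have "A *v u = m *\<^sub>R u"
    by (simp add: y_def)
  moreover have "norm u = 1" "\<forall>j\<in>J. u \<bullet> v j = 0"
    using u(1) by (auto simp: W_def)
  moreover have "x \<bullet> (A *v x) \<le> m * (norm x)\<^sup>2" if "\<forall>j\<in>J. x \<bullet> v j = 0" for x
    using that by (intro bound) (simp add: W_def)
  ultimately show ?thesis
    by blast
qed

lemma spectral_theorem:
  fixes A :: "real^'n::{finite,linorder}^'n::{finite,linorder}"
  assumes sym: "transpose A = A"
  shows "\<exists>V l. eigen_decomp A V l"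
proof -
  define P where "P = (\<lambda>(J::'n set) v l.
     (\<forall>i\<in>J. \<forall>j\<in>J. v i \<bullet> v j = (if i = j then 1 else 0)) \<and> (\<forall>j\<in>J. A *v v j = l j *\<^sub>R v j) \<and>
     (\<forall>i\<in>J. \<forall>j\<in>J. i \<le> j \<longrightarrow> l j \<le> l i) \<and>
     (\<forall>i\<in>J. \<forall>x. (\<forall>j\<in>J. x \<bullet> v j = 0) \<longrightarrow> x \<bullet> (A *v x) \<le> l i * (norm x)\<^sup>2))"
  have "\<exists>v l. P J v l" for J
  proof (induction J rule: finite_linorder_max_induct [OF finite])
    case 1
    then show ?case by (simp add: P_def)
  next
    case (2 b J)
    then obtain v l where P: "P J v l"
      by blast
    have bJ: "b \<notin> J"
      using 2 by auto
    then have cJ: "card J < CARD('n)"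
      by (metis UNIV_I card_seteq finite not_le subset_UNIV)
    note P = P [unfolded P_def]
    note Porth = P [THEN conjunct1] and eig = P [THEN conjunct2, THEN conjunct1, rule_format]
      and Psort = P [THEN conjunct2, THEN conjunct2, THEN conjunct1]
      and Pmax = P [THEN conjunct2, THEN conjunct2, THEN conjunct2, rule_format]
    have "\<exists>u m. norm u = 1 \<and> (\<forall>j\<in>J. u \<bullet> v j = 0) \<and> A *v u = m *\<^sub>R u \<and>
        (\<forall>x. (\<forall>j\<in>J. x \<bullet> v j = 0) \<longrightarrow> x \<bullet> (A *v x) \<le> m * (norm x)\<^sup>2)"
      by (rule rayleigh_maximizer [OF sym 2(1) cJ]) (rule eig)
    then obtain u m where u: "norm u = 1" "\<forall>j\<in>J. u \<bullet> v j = 0" "A *v u = m *\<^sub>R u"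
      "\<forall>x. (\<forall>j\<in>J. x \<bullet> v j = 0) \<longrightarrow> x \<bullet> (A *v x) \<le> m * (norm x)\<^sup>2"
      by (elim exE conjE)
    have uu: "u \<bullet> u = 1"
      using u(1) by (simp add: norm_eq_sqrt_inner)
    have vu: "\<forall>j\<in>J. v j \<bullet> u = 0"
      using u(2) by (simp add: inner_commute)
    have ml: "m \<le> l i" if "i \<in> J" for i
    proof -
      have "u \<bullet> (A *v u) \<le> l i * (norm u)\<^sup>2"
        by (rule Pmax [OF that]) (rule u(2) [rule_format])
      then show ?thesis
        by (simp only: u(1,3) uu inner_scaleR_right mult_1_right power_one)
    qed
    let ?v = "v(b := u)" and ?l = "l(b := m)"
    have "\<forall>i\<in>insert b J. \<forall>j\<in>insert b J. ?v i \<bullet> ?v j = (if i = j then 1 else 0)"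
      using Porth uu u(2) vu bJ by auto
    moreover have "\<forall>j\<in>insert b J. A *v ?v j = ?l j *\<^sub>R ?v j"
      using eig u(3) by auto
    moreover have "\<forall>i\<in>insert b J. \<forall>j\<in>insert b J. i \<le> j \<longrightarrow> ?l j \<le> ?l i"
      using Psort ml 2(2) by auto
    moreover have "\<forall>i\<in>insert b J. \<forall>x. (\<forall>j\<in>insert b J. x \<bullet> ?v j = 0) \<longrightarrow>
        x \<bullet> (A *v x) \<le> ?l i * (norm x)\<^sup>2"
    proof (intro ballI allI impI)
      fix i x
      assume i: "i \<in> insert b J" and x': "\<forall>j\<in>insert b J. x \<bullet> ?v j = 0"
      have x: "x \<bullet> v j = 0" if "j \<in> J" for j
        using x' [rule_format, of j] that bJ by (cases "j = b") auto
      show "x \<bullet> (A *v x) \<le> ?l i * (norm x)\<^sup>2"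
      proof (cases "i = b")
        case True
        then show ?thesis
          using u(4) [rule_format, of x] x by simp
      next
        case False
        then show ?thesis
          using Pmax [of i x] x i by simp
      qed
    qed
    ultimately have "P (insert b J) ?v ?l"
      unfolding P_def by (intro conjI)
    then show ?case by (intro exI)
  qed
  then obtain v l where P: "P UNIV v l"
    by blast
  define V where "V = (\<chi> a i. v i $ a)"
  have col: "column i V = v i" for i
    by (simp add: V_def column_def vec_eq_iff)
  have "orthonormal_cols V"
    using P by (auto simp: orthonormal_cols_iff col P_def)
  then have oV: "orthogonal_matrix V"
    by (simp add: orthogonal_matrix orthonormal_cols_def)
  have "A ** V = V ** Diag (\<chi> i. l i)"
  proof -
    have "(A ** V) $ a $ i = (V ** Diag (\<chi> i. l i)) $ a $ i" for a i
    proof -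
      have "(A ** V) $ a $ i = (A *v v i) $ a"
        by (simp add: matrix_matrix_mult_def matrix_vector_mult_def V_def)
      also have "\<dots> = l i * v i $ a"
        using P by (simp add: P_def)
      also have "\<dots> = (V ** Diag (\<chi> i. l i)) $ a $ i"
        by (simp add: matrix_matrix_mult_def V_def Diag_def if_distrib [of "\<lambda>x. _ * x"]
            sum.delta mult.commute cong: if_cong)
      finally show ?thesis .
    qed
    then show ?thesis
      by (simp add: vec_eq_iff)
  qed
  then have "A = V ** Diag (\<chi> i. l i) ** transpose V"
    using oV by (metis matrix_mul_assoc matrix_mul_rid orthogonal_matrix_def)
  then have "eigen_decomp A V (\<chi> i. l i)"
    using oV P by (simp add: eigen_decomp_def P_def)
  then show ?thesis by blast
qed

lemma quadratic_form_decomp: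
  assumes "orthogonal_matrix V"
  shows "(V *v z) \<bullet> ((V ** Diag l ** transpose V) *v (V *v z)) = (\<Sum>i\<in>UNIV. l $ i * (z $ i)\<^sup>2)"
  using assms
  by (simp add: orthogonal_matrix_cancel orthonormal_cols_inner [OF orthogonal_matrix_cols]
      inner_Diag flip: matrix_vector_mul_assoc)

text \<open>The span of the leading eigenvectors of one decomposition up to j meets the span of the
  trailing eigenvectors of the other from j on, for dimension reasons.\<close>

lemma eigen_decomp_le:
  fixes X :: "real^'n::{finite,linorder}^'n::{finite,linorder}"
  assumes V: "eigen_decomp X V l" and W: "eigen_decomp X W m"
  shows "l $ j \<le> m $ j"
proof (rule ccontr)
  assume less: "\<not> l $ j \<le> m $ j"
  have oV: "orthogonal_matrix V" and oW: "orthogonal_matrix W"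
    using V W by (auto simp: eigen_decomp_def)
  let ?S = "(*v) V ` {z. \<forall>i. i \<notin> {..j} \<longrightarrow> z $ i = 0}"
  let ?T = "(*v) W ` {z. \<forall>i. i \<notin> {j..} \<longrightarrow> z $ i = 0}"
  have sub: "subspace ?S" "subspace ?T"
    using subspace_supported by (intro linear_subspace_image; blast intro: matrix_vector_mul_linear)+
  have "card {..j} + card {j..} = card ({..j} \<union> {j..}) + card ({..j} \<inter> {j..})"
    by (rule card_Un_Int) auto
  also have "{..j} \<union> {j..} = UNIV"
    by auto
  also have "{..j} \<inter> {j..} = {j}"
    by auto
  finally have "dim ?S + dim ?T = CARD('n) + 1"
    by (simp only: dim_image_supported [OF oV] dim_image_supported [OF oW]) simp
  moreover have "dim {x + y |x y. x \<in> ?S \<and> y \<in> ?T} \<le> CARD('n)"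
    using dim_subset_UNIV_cart by (auto simp flip: dim_vec_eq)
  ultimately have "dim (?S \<inter> ?T) \<noteq> 0"
    using dim_sums_Int [OF sub] by linarith
  then obtain x where x: "x \<in> ?S" "x \<in> ?T" "x \<noteq> 0"
    by (auto simp: dim_eq_0)
  obtain z where z: "x = V *v z" "\<And>i. \<not> i \<le> j \<Longrightarrow> z $ i = 0"
    using x(1) by auto
  obtain w where w: "x = W *v w" "\<And>i. \<not> j \<le> i \<Longrightarrow> w $ i = 0"
    using x(2) by auto
  have "l $ j * (norm x)\<^sup>2 = (\<Sum>i\<in>UNIV. l $ j * (z $ i)\<^sup>2)"
    by (simp add: z orthonormal_cols_norm [OF orthogonal_matrix_cols [OF oV]] norm_sq_cart
        sum_distrib_left)
  also have "\<dots> \<le> (\<Sum>i\<in>UNIV. l $ i * (z $ i)\<^sup>2)"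
  proof (rule sum_mono)
    fix i
    show "l $ j * (z $ i)\<^sup>2 \<le> l $ i * (z $ i)\<^sup>2"
      using V z(2) [of i] by (cases "i \<le> j") (auto simp: eigen_decomp_def intro: mult_right_mono)
  qed
  also have "\<dots> = x \<bullet> (X *v x)"
    using V quadratic_form_decomp [OF oV, of z l] by (simp add: z eigen_decomp_def)
  also have "\<dots> = (\<Sum>i\<in>UNIV. m $ i * (w $ i)\<^sup>2)"
    using W quadratic_form_decomp [OF oW, of w m] by (simp add: w(1) eigen_decomp_def)
  also have "\<dots> \<le> (\<Sum>i\<in>UNIV. m $ j * (w $ i)\<^sup>2)"
  proof (rule sum_mono)
    fix i
    show "m $ i * (w $ i)\<^sup>2 \<le> m $ j * (w $ i)\<^sup>2"
      using W w(2) [of i] by (cases "j \<le> i") (auto simp: eigen_decomp_def intro: mult_right_mono)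
  qed
  also have "\<dots> = m $ j * (norm x)\<^sup>2"
    by (simp add: w(1) orthonormal_cols_norm [OF orthogonal_matrix_cols [OF oW]] norm_sq_cart
        sum_distrib_left)
  finally show False
    using less x(3) by simp
qed

lemma eigen_decomp_unique:
  assumes "eigen_decomp X V l" "eigen_decomp X W m"
  shows "l = m"
  using eigen_decomp_le [OF assms] eigen_decomp_le [OF assms(2,1)] by (simp add: vec_eq_iff order_antisym)

lemma eigvals_decomp:
  assumes "transpose A = A"
  obtains V where "eigen_decomp A V (eigvals A)"
proof -
  obtain V l where V: "eigen_decomp A V l"
    using spectral_theorem [OF assms] by blast
  have "\<exists>V. eigen_decomp A V (eigvals A)"
    unfolding eigvals_def by (rule theI2) (use V eigen_decomp_unique in blast)+
  then show thesis
    using that by blast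
qed

subsection \<open>Principal angles\<close>

text \<open>M is injective on the span of the eigenvectors of its Gram matrix with index in J, whose
  dimension is that of the coordinate space containing the range.\<close>

lemma surjective_of_eigenvalue_bound:
  fixes M :: "real^'p^'n" and l :: "real^'p"
  assumes W: "orthogonal_matrix W" and decomp: "transpose M ** M = W ** Diag l ** transpose W"
    and l: "\<And>j. j \<in> J \<Longrightarrow> s \<le> l $ j" and s: "s > 0" and card: "card J = card I"
    and range: "\<And>y i. i \<notin> I \<Longrightarrow> (M *v y) $ i = 0"
    and z: "\<And>i. i \<notin> I \<Longrightarrow> z $ i = 0"
  obtains y where "M *v y = z" "s * (norm y)\<^sup>2 \<le> (norm z)\<^sup>2"
proof -
  let ?J = "{c :: real^'p. \<forall>j. j \<notin> J \<longrightarrow> c $ j = 0}"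
  let ?I = "{c :: real^'n. \<forall>i. i \<notin> I \<longrightarrow> c $ i = 0}"
  let ?f = "\<lambda>c. M *v (W *v c)"
  have bound: "s * (norm c)\<^sup>2 \<le> (norm (?f c))\<^sup>2" if "c \<in> ?J" for c
  proof -
    have "s * (norm c)\<^sup>2 = (\<Sum>j\<in>UNIV. s * (c $ j)\<^sup>2)"
      by (simp add: norm_sq_cart sum_distrib_left)
    also have "\<dots> \<le> (\<Sum>j\<in>UNIV. l $ j * (c $ j)\<^sup>2)"
    proof (rule sum_mono)
      fix j
      show "s * (c $ j)\<^sup>2 \<le> l $ j * (c $ j)\<^sup>2"
        using that l by (cases "j \<in> J") (auto intro: mult_right_mono)
    qed
    also have "\<dots> = (W *v c) \<bullet> ((transpose M ** M) *v (W *v c))"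
      by (simp add: decomp quadratic_form_decomp [OF W])
    also have "\<dots> = ?f c \<bullet> ?f c"
      by (simp add: inner_matrix_vector_left flip: matrix_vector_mul_assoc)
    finally show ?thesis
      by (simp add: power2_norm_eq_inner)
  qed
  have lin: "linear ?f"
    by (simp add: matrix_vector_mul_assoc)
  have "inj_on ?f ?J"
  proof (rule inj_onI)
    fix c e
    assume ce: "c \<in> ?J" "e \<in> ?J" "?f c = ?f e"
    then have "s * (norm (c - e))\<^sup>2 \<le> 0"
      using bound [of "c - e"] by (simp add: matrix_vector_mult_diff_distrib)
    then show "c = e"
      using s by (simp add: mult_le_0_iff)
  qed
  then have "dim (?f ` ?J) = dim ?J"
    by (intro dim_image_eq lin) (simp add: span_eq_iff [THEN iffD2, OF subspace_supported])
  then have "dim (?f ` ?J) = dim ?I"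
    by (simp only: dim_supported card)
  moreover have "?f ` ?J \<subseteq> ?I"
    using range by auto
  ultimately have "?f ` ?J = ?I"
    by (intro subspace_dim_equal linear_subspace_image lin subspace_supported) auto
  then have "z \<in> ?f ` ?J"
    using z by blast
  then obtain c where c: "c \<in> ?J" "z = ?f c"
    by blast
  show thesis
  proof
    show "M *v (W *v c) = z"
      using c by simp
    show "s * (norm (W *v c))\<^sup>2 \<le> (norm z)\<^sup>2"
      using bound [OF c(1)] c(2) by (simp add: orthonormal_cols_norm [OF orthogonal_matrix_cols [OF W]])
  qed
qed

lemma card_first_positions:
  assumes "m \<le> CARD('p::{finite,linorder})"
  shows "card {j::'p. card {..<j} < m} = m"
proof -
  let ?r = "\<lambda>j::'p. card {..<j}"
  have mono: "?r i < ?r j" if "i < j" for i j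
    using that by (intro psubset_card_mono) auto
  have inj: "inj ?r"
    by (rule injI) (metis mono less_irrefl neqE)
  have "?r j < CARD('p)" for j
    by (intro psubset_card_mono) auto
  then have "range ?r \<subseteq> {..<CARD('p)}"
    by auto
  then have surj: "range ?r = {..<CARD('p)}"
    by (intro card_subset_eq) (auto simp: card_image [OF inj])
  have "?r ` {j. ?r j < m} = {..<m}"
  proof (intro equalityI subsetI)
    fix k assume "k \<in> {..<m}"
    then have "k \<in> range ?r"
      using assms by (auto simp: surj)
    then show "k \<in> ?r ` {j. ?r j < m}"
      using \<open>k \<in> {..<m}\<close> by auto
  qed auto
  then show ?thesis
    using card_image [OF inj_on_subset [OF inj subset_UNIV], of "{j. ?r j < m}"] by simp
qed

lemma transpose_sub_cols_mult:
  "transpose (sub_cols V I) *v x = (\<chi> i. if i \<in> I then (transpose V *v x) $ i else 0)"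
  by (auto simp: vec_eq_iff matrix_vector_mult_def transpose_def sub_cols_def intro!: sum.neutral)

lemma norm_mono_cart:
  fixes x y :: "real^'n"
  assumes "\<And>i. \<bar>x $ i\<bar> \<le> \<bar>y $ i\<bar>"
  shows "norm x \<le> norm y"
  by (rule norm_le_componentwise_cart) (use assms in auto)

lemma spectral_norm_nonneg: "0 \<le> spectral_norm A"
  unfolding spectral_norm_def by (intro onorm_pos_le) simp

lemma angle_bound_imp_surjective:
  fixes V :: "real^'n^'n" and U :: "real^'p::{finite,linorder}^'n"
  assumes V: "orthogonal_matrix V" and U: "orthonormal_cols U" and card: "card I \<le> CARD('p)"
    and angle: "spectral_norm (sin_mat (Theta V I U)) < \<gamma>" and \<gamma>: "\<gamma> < 1"
    and z: "\<And>i. i \<notin> I \<Longrightarrow> z $ i = 0"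
  obtains y where "transpose (sub_cols V I) *v (U *v y) = z" "(1 - \<gamma>\<^sup>2) * (norm y)\<^sup>2 \<le> (norm z)\<^sup>2"
proof -
  define M where "M = transpose (sub_cols V I) ** U"
  have Mv: "M *v y = transpose (sub_cols V I) *v (U *v y)" for y
    by (simp add: M_def flip: matrix_vector_mul_assoc)
  have M_le: "norm (M *v y) \<le> norm y" for y
  proof -
    have "norm (M *v y) \<le> norm (transpose V *v (U *v y))"
      unfolding Mv transpose_sub_cols_mult by (rule norm_mono_cart) auto
    then show ?thesis
      using orthonormal_cols_norm [OF orthogonal_matrix_transpose_cols [OF V]] orthonormal_cols_norm [OF U]
      by simp
  qed
  define l where "l = eigvals (transpose M ** M)"
  have "transpose (transpose M ** M) = transpose M ** M"
    by (simp add: matrix_transpose_mul)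
  then obtain W where "eigen_decomp (transpose M ** M) W l"
    unfolding l_def using eigvals_decomp by blast
  then have W: "orthogonal_matrix W" and decomp: "transpose M ** M = W ** Diag l ** transpose W"
    by (auto simp: eigen_decomp_def)
  have l_eq: "l $ j = (norm (M *v (W *v axis j 1)))\<^sup>2" for j
  proof -
    have "(norm (M *v (W *v axis j 1)))\<^sup>2 =
        (W *v axis j 1) \<bullet> ((transpose M ** M) *v (W *v axis j 1))"
      by (simp add: power2_norm_eq_inner inner_matrix_vector_left
          flip: matrix_vector_mul_assoc)
    also have "\<dots> = (\<Sum>i\<in>UNIV. l $ i * (axis j 1 $ i)\<^sup>2)"
      unfolding decomp by (rule quadratic_form_decomp [OF W])
    also have "\<dots> = (\<Sum>i\<in>UNIV. if i = j then l $ i else 0)"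
      by (intro sum.cong) (auto simp: axis_def)
    finally show ?thesis
      by simp
  qed
  have l01: "0 \<le> l $ j" "l $ j \<le> 1" for j
  proof -
    show "0 \<le> l $ j"
      by (simp add: l_eq)
    have "norm (M *v (W *v axis j 1)) \<le> 1"
      using M_le [of "W *v axis j 1"] orthonormal_cols_norm [OF orthogonal_matrix_cols [OF W]]
      by simp
    then show "l $ j \<le> 1"
      by (simp add: l_eq power_le_one)
  qed
  have \<gamma>0: "0 \<le> \<gamma>"
    using angle spectral_norm_nonneg [of "sin_mat (Theta V I U)"] by simp
  then have \<gamma>2: "\<gamma>\<^sup>2 < 1"
    using \<gamma> by (simp add: power_less_one_iff)
  have l_ge: "1 - \<gamma>\<^sup>2 \<le> l $ j" if "card {..<j} < card I" for j
  proof -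
    have "\<bar>sin_mat (Theta V I U) $ j $ j\<bar> < \<gamma>"
      using angle matrix_component_le_onorm [of "sin_mat (Theta V I U)" j j]
      by (simp add: spectral_norm_def)
    then have "\<bar>sin (arccos (sqrt (l $ j)))\<bar> < \<gamma>"
      using that by (simp add: sin_mat_def Theta_def Diag_def sing_vals_def l_def M_def)
    moreover have "sin (arccos (sqrt (l $ j))) = sqrt (1 - l $ j)"
      using l01 [of j] by (subst sin_arccos_abs) auto
    ultimately have "\<bar>sqrt (1 - l $ j)\<bar> < \<gamma>"
      by simp
    then have "(sqrt (1 - l $ j))\<^sup>2 \<le> \<gamma>\<^sup>2"
      using \<gamma>0 by (intro power2_le_iff_abs_le [THEN iffD2]) auto
    then show ?thesis
      using l01 [of j] by simp
  qed
  show thesis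
  proof (rule surjective_of_eigenvalue_bound [OF W decomp])
    show "1 - \<gamma>\<^sup>2 \<le> l $ j" if "j \<in> {j. card {..<j} < card I}" for j
      using l_ge that by simp
    show "card {j::'p. card {..<j} < card I} = card I"
      by (rule card_first_positions [OF card])
    show "(M *v y) $ i = 0" if "i \<notin> I" for y i
      using that by (simp add: Mv transpose_sub_cols_mult)
  qed (use \<gamma>2 z that Mv in auto)
qed

subsection \<open>Chebyshev filters\<close>

lemma cheb_cos: "poly (cheb d) (cos \<theta>) = cos (real d * \<theta>)"
proof (induction d rule: cheb.induct)
  case (3 d)
  have "cos (real (Suc (Suc d)) * \<theta>) + cos (real d * \<theta>) = 2 * cos \<theta> * cos (real (Suc d) * \<theta>)"
    using cos_add [of "real (Suc d) * \<theta>" \<theta>] cos_diff [of "real (Suc d) * \<theta>" \<theta>]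
    by (simp add: algebra_simps)
  then show ?case
    using 3 by (simp add: algebra_simps)
qed auto

lemma abs_cheb_le_1:
  assumes "\<bar>t\<bar> \<le> 1"
  shows "\<bar>poly (cheb d) t\<bar> \<le> 1"
  using cheb_cos [of d "arccos t"] assms by (simp add: cos_arccos_abs)

lemma cheb_minus: "poly (cheb d) (- t) = (- 1) ^ d * poly (cheb d) t"
  by (induction d rule: cheb.induct) (auto simp: algebra_simps)

lemma cheb_ge_linear:
  assumes "t \<ge> 1"
  shows "1 + real d * (t - 1) \<le> poly (cheb d) t"
proof -
  have "t - 1 \<le> poly (cheb (Suc d)) t - poly (cheb d) t \<and> 1 \<le> poly (cheb d) t" for d
  proof (induction d)
    case (Suc d)
    have "poly (cheb (Suc (Suc d))) t - poly (cheb (Suc d)) t =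
        (poly (cheb (Suc d)) t - poly (cheb d) t) + 2 * (t - 1) * poly (cheb (Suc d)) t"
      by (simp add: algebra_simps)
    moreover have "1 \<le> poly (cheb (Suc d)) t"
      using Suc assms by linarith
    then have "0 \<le> 2 * (t - 1) * poly (cheb (Suc d)) t"
      using assms by (intro mult_nonneg_nonneg) auto
    ultimately show ?case
      using Suc \<open>1 \<le> poly (cheb (Suc d)) t\<close> by linarith
  qed auto
  then have step: "poly (cheb d) t + (t - 1) \<le> poly (cheb (Suc d)) t" for d
    by (metis add.commute le_diff_eq)
  show ?thesis
  proof (induction d)
    case (Suc d)
    then show ?case
      using step [of d] by (simp add: algebra_simps)
  qed auto
qed

lemma abs_cheb_ge_linear:
  assumes "\<bar>t\<bar> \<ge> 1 + e" "e \<ge> 0"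
  shows "1 + real d * e \<le> \<bar>poly (cheb d) t\<bar>"
proof -
  have "\<bar>poly (cheb d) t\<bar> = \<bar>poly (cheb d) \<bar>t\<bar>\<bar>"
    by (cases "t \<ge> 0") (auto simp: cheb_minus [of d t] abs_mult)
  moreover have "1 + real d * e \<le> 1 + real d * (\<bar>t\<bar> - 1)"
    using assms by (intro add_left_mono mult_left_mono) auto
  ultimately show ?thesis
    using cheb_ge_linear [of "\<bar>t\<bar>" d] assms by linarith
qed

lemma poly_cheb_filter:
  assumes "a < b"
  shows "poly (cheb_filter d a b) t = poly (cheb d) ((t - (a + b) / 2) / ((b - a) / 2))"
  by (simp add: cheb_filter_def poly_pcompose diff_divide_distrib [of t] add.commute
      del: divide_divide_eq_right divide_divide_eq_left)

lemma abs_cheb_filter_le_1: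
  assumes "a < b" "t \<in> {a..b}"
  shows "\<bar>poly (cheb_filter d a b) t\<bar> \<le> 1"
  unfolding poly_cheb_filter [OF assms(1)] using assms
  by (intro abs_cheb_le_1) (auto simp: abs_le_iff field_simps)

lemma abs_cheb_filter_ge_linear:
  assumes "a < b" "e \<ge> 0" "e \<le> \<bar>t - (a + b) / 2\<bar> / ((b - a) / 2) - 1"
  shows "1 + real d * e \<le> \<bar>poly (cheb_filter d a b) t\<bar>"
proof -
  have "\<bar>(t - (a + b) / 2) / ((b - a) / 2)\<bar> = \<bar>t - (a + b) / 2\<bar> / ((b - a) / 2)"
    using assms(1) by (subst abs_divide) simp
  then show ?thesis
    unfolding poly_cheb_filter [OF assms(1)] using assms by (intro abs_cheb_ge_linear) linarith+
qed

lemma poly_mat_decomp: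
  assumes V: "orthogonal_matrix V"
  shows "poly_mat p (V ** Diag l ** transpose V) *v (V *v z) = V *v (\<chi> i. poly p (l $ i) * z $ i)"
proof -
  let ?A = "V ** Diag l ** transpose V"
  have A: "?A *v (V *v z) = V *v (\<chi> i. l $ i * z $ i)" for z
    by (simp add: orthogonal_matrix_cancel [OF V] Diag_mult_vec
        flip: matrix_vector_mul_assoc)
  have pow: "((**) ?A ^^ k) (mat 1) *v (V *v z) = V *v (\<chi> i. l $ i ^ k * z $ i)" for k
  proof (induction k)
    case (Suc k)
    have "((**) ?A ^^ Suc k) (mat 1) *v (V *v z) = ?A *v (((**) ?A ^^ k) (mat 1) *v (V *v z))"
      by (simp only: funpow.simps o_apply flip: matrix_vector_mul_assoc)
    then show ?case
      by (simp only: Suc A) (simp add: mult.assoc)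
  qed simp
  have lin: "linear (\<lambda>A :: real^'a^'a. A *v x)" for x
    by (auto intro!: linearI simp: matrix_vector_mult_add_rdistrib scaleR_matrix_vector_assoc)
  have "poly_mat p ?A *v (V *v z) =
      (\<Sum>k\<le>degree p. (coeff p k *\<^sub>R ((**) ?A ^^ k) (mat 1)) *v (V *v z))"
    unfolding poly_mat_def by (rule linear_sum [OF lin])
  also have "\<dots> = (\<Sum>k\<le>degree p. V *v (coeff p k *\<^sub>R (\<chi> i. l $ i ^ k * z $ i)))"
    by (simp only: pow matrix_vector_mult_scaleR flip: scaleR_matrix_vector_assoc)
  also have "\<dots> = V *v (\<Sum>k\<le>degree p. coeff p k *\<^sub>R (\<chi> i. l $ i ^ k * z $ i))"
    by (rule linear_sum [symmetric]) simp
  also have "(\<Sum>k\<le>degree p. coeff p k *\<^sub>R (\<chi> i. l $ i ^ k * z $ i)) = (\<chi> i. poly p (l $ i) * z $ i)"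
    by (simp add: vec_eq_iff poly_altdef sum_distrib_right mult.assoc)
  finally show ?thesis .
qed

lemma orthonormal_cols_cancel:
  assumes "orthonormal_cols Q"
  shows "transpose Q *v (Q *v y) = y"
  using assms by (simp add: matrix_vector_mul_assoc orthonormal_cols_def)

lemma norm_residual:
  assumes "orthonormal_cols Q"
  shows "(norm (w - Q *v (transpose Q *v w)))\<^sup>2 = (norm w)\<^sup>2 - (norm (transpose Q *v w))\<^sup>2"
proof -
  have "w \<bullet> (Q *v (transpose Q *v w)) = (norm (transpose Q *v w))\<^sup>2"
    using inner_matrix_vector_left [of Q "transpose Q *v w" w]
    by (simp add: power2_norm_eq_inner inner_commute)
  moreover have "(norm (Q *v (transpose Q *v w)))\<^sup>2 = (norm (transpose Q *v w))\<^sup>2"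
    by (simp add: orthonormal_cols_norm [OF assms])
  ultimately show ?thesis
    unfolding power2_norm_eq_inner by (simp add: inner_diff_left inner_diff_right inner_commute)
qed

lemma norm_residual_le:
  assumes "orthonormal_cols Q"
  shows "norm (w - Q *v (transpose Q *v w)) \<le> norm (w - Q *v y)"
proof -
  let ?v = "w - Q *v y"
  have "?v - Q *v (transpose Q *v ?v) = w - Q *v (transpose Q *v w)"
    by (simp add: matrix_vector_mult_diff_distrib orthonormal_cols_cancel [OF assms])
  then have "(norm (w - Q *v (transpose Q *v w)))\<^sup>2 = (norm ?v)\<^sup>2 - (norm (transpose Q *v ?v))\<^sup>2"
    using norm_residual [OF assms, of ?v] by (simp only:)
  then have "(norm (w - Q *v (transpose Q *v w)))\<^sup>2 \<le> (norm ?v)\<^sup>2"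
    by simp
  then show ?thesis
    by (rule power2_le_imp_le) simp
qed

lemma filter_approximation:
  fixes V :: "real^'n^'n" and U :: "real^'p::{finite,linorder}^'n"
  assumes V: "orthogonal_matrix V" and U: "orthonormal_cols U" and card: "card I \<le> CARD('p)"
    and angle: "spectral_norm (sin_mat (Theta V I U)) < \<gamma>" and \<gamma>: "0 \<le> \<gamma>" "\<gamma> < 1"
    and wanted: "\<And>i. i \<in> I \<Longrightarrow> T \<le> \<bar>poly p (l $ i)\<bar>" and T: "0 < T"
    and unwanted: "\<And>i. i \<notin> I \<Longrightarrow> \<bar>poly p (l $ i)\<bar> \<le> 1"
    and Q: "is_orth Q (poly_mat p (V ** Diag l ** transpose V) ** U)" and i: "i \<in> I"
  shows "norm (column i V - Q *v (transpose Q *v column i V)) \<le> 1 / (T * sqrt (1 - \<gamma>\<^sup>2))"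
proof -
  define c where "c = poly p (l $ i)"
  have c: "T \<le> \<bar>c\<bar>"
    using wanted [OF i] by (simp add: c_def)
  have "axis i (1 / c) $ j = 0" if "j \<notin> I" for j
    using that i by (auto simp: axis_def)
  then obtain y where y: "transpose (sub_cols V I) *v (U *v y) = axis i (1 / c)"
      "(1 - \<gamma>\<^sup>2) * (norm y)\<^sup>2 \<le> (norm (axis i (1 / c)))\<^sup>2"
    using angle_bound_imp_surjective [OF V U card angle \<gamma>(2), of "axis i (1 / c)"] by blast
  define r where "r = transpose V *v (U *v y)"
  have Uy: "U *v y = V *v r"
    by (simp add: r_def orthogonal_matrix_cancel [OF V])
  have rI: "r $ j = axis i (1 / c) $ j" if "j \<in> I" for j
    using that unfolding y(1) [symmetric] transpose_sub_cols_mult by (simp add: r_def)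
  obtain T' where T': "poly_mat p (V ** Diag l ** transpose V) ** U = Q ** T'"
      and oQ: "orthonormal_cols Q"
    using Q by (auto simp: is_orth_def)
  have "Q *v (T' *v y) = poly_mat p (V ** Diag l ** transpose V) *v (U *v y)"
    by (simp only: matrix_vector_mul_assoc T')
  also have "\<dots> = V *v (\<chi> j. poly p (l $ j) * r $ j)"
    by (simp only: Uy poly_mat_decomp [OF V])
  finally have Qy: "Q *v (T' *v y) = V *v (\<chi> j. poly p (l $ j) * r $ j)" .
  have "norm (column i V - Q *v (transpose Q *v column i V)) \<le> norm (column i V - Q *v (T' *v y))"
    by (rule norm_residual_le [OF oQ])
  also have "column i V - Q *v (T' *v y) = V *v (axis i 1 - (\<chi> j. poly p (l $ j) * r $ j))"
    by (simp only: Qy column_eq_mult_axis matrix_vector_mult_diff_distrib)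
  also have "norm \<dots> = norm (axis i 1 - (\<chi> j. poly p (l $ j) * r $ j))"
    by (rule orthonormal_cols_norm [OF orthogonal_matrix_cols [OF V]])
  also have "\<dots> \<le> norm r"
  proof (rule norm_mono_cart)
    fix j
    show "\<bar>(axis i 1 - (\<chi> j. poly p (l $ j) * r $ j)) $ j\<bar> \<le> \<bar>r $ j\<bar>"
    proof (cases "j \<in> I")
      case True
      then show ?thesis
        using rI [OF True] c T by (auto simp: axis_def c_def)
    next
      case False
      then have "\<bar>poly p (l $ j)\<bar> * \<bar>r $ j\<bar> \<le> 1 * \<bar>r $ j\<bar>"
        by (intro mult_right_mono unwanted) auto
      then show ?thesis
        using False i by (auto simp: axis_def abs_mult)
    qed
  qed
  also have "norm r = norm y"
    unfolding r_def using orthonormal_cols_norm [OF orthogonal_matrix_transpose_cols [OF V]]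
      orthonormal_cols_norm [OF U] by simp
  also have "norm y \<le> 1 / (T * sqrt (1 - \<gamma>\<^sup>2))"
  proof -
    have \<gamma>2: "\<gamma>\<^sup>2 < 1"
      using \<gamma> by (simp add: power_less_one_iff)
    have "(sqrt (1 - \<gamma>\<^sup>2) * norm y)\<^sup>2 \<le> (1 / c)\<^sup>2"
      using y(2) \<gamma>2 by (simp add: power_mult_distrib power_divide inner_axis_axis
          power2_norm_eq_inner [of "axis i (1 / c)"] flip: power2_eq_square)
    also have "\<dots> = (1 / \<bar>c\<bar>)\<^sup>2"
      by (simp add: power_divide)
    also have "\<dots> \<le> (1 / T)\<^sup>2"
      using c T by (intro power_mono divide_left_mono) auto
    finally have "sqrt (1 - \<gamma>\<^sup>2) * norm y \<le> 1 / T"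
      by (rule power2_le_imp_le) (use T in simp)
    then show ?thesis
      using T \<gamma>2 by (simp add: field_simps)
  qed
  finally show ?thesis .
qed

subsection \<open>Projections onto nearby subspaces\<close>

lemma inner_matrix_eq_trace: "A \<bullet> B = trace (transpose A ** B)" for A B :: "real^'b^'a"
  unfolding inner_vec_def trace_def matrix_matrix_mult_def transpose_def
  by (simp, rule sum.swap)

lemma trace_congruence: "trace (transpose S ** A ** S) = (\<Sum>j\<in>UNIV. column j S \<bullet> (A *v column j S))"
proof -
  have "(transpose S ** A ** S) $ j $ j = column j S \<bullet> (A *v column j S)" for j
  proof -
    have "(transpose S ** A ** S) $ j $ j = (transpose S *v (A *v column j S)) $ j"
      unfolding matrix_vector_mul_assoc
      by (simp add: matrix_matrix_mult_def [of "transpose S ** A" S] matrix_vector_mult_def column_def)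
    also have "\<dots> = column j S \<bullet> (A *v column j S)"
      by (simp add: matrix_vector_mult_def transpose_def column_def inner_vec_def)
    finally show ?thesis .
  qed
  then show ?thesis
    by (simp add: trace_def)
qed

lemma inner_projections:
  fixes S :: "real^'p^'n" and Q :: "real^'q^'n"
  shows "(S ** transpose S) \<bullet> (Q ** transpose Q) = (\<Sum>j\<in>UNIV. (norm (transpose Q *v column j S))\<^sup>2)"
proof -
  have "(S ** transpose S) \<bullet> (Q ** transpose Q) = trace (S ** (transpose S ** (Q ** transpose Q)))"
    by (simp add: inner_matrix_eq_trace matrix_transpose_mul matrix_mul_assoc)
  also have "\<dots> = trace (transpose S ** (Q ** transpose Q) ** S)"
    by (rule trace_mul_sym)
  also have "\<dots> = (\<Sum>j\<in>UNIV. (norm (transpose Q *v column j S))\<^sup>2)"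
    unfolding trace_congruence
    by (simp add: power2_norm_eq_inner inner_matrix_vector_left flip: matrix_vector_mul_assoc)
  finally show ?thesis .
qed

lemma norm_projection:
  fixes Q :: "real^'p^'n"
  assumes "orthonormal_cols Q"
  shows "(norm (Q ** transpose Q))\<^sup>2 = real CARD('p)"
  by (simp add: power2_norm_eq_inner [of "Q ** transpose Q"] inner_projections column_eq_mult_axis
      orthonormal_cols_cancel [OF assms])

lemma norm_diff_projections:
  fixes S Q :: "real^'p^'n"
  assumes S: "orthonormal_cols S" and Q: "orthonormal_cols Q"
  shows "(norm (S ** transpose S - Q ** transpose Q))\<^sup>2 =
    2 * (\<Sum>j\<in>UNIV. (norm (column j S - Q *v (transpose Q *v column j S)))\<^sup>2)"
proof -
  let ?P = "S ** transpose S" and ?P' = "Q ** transpose Q"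
  have "(norm (?P - ?P'))\<^sup>2 = (norm ?P)\<^sup>2 + (norm ?P')\<^sup>2 - 2 * (?P \<bullet> ?P')"
    unfolding power2_norm_eq_inner by (simp add: inner_diff_left inner_diff_right inner_commute)
  also have "\<dots> = 2 * (real CARD('p) - (\<Sum>j\<in>UNIV. (norm (transpose Q *v column j S))\<^sup>2))"
    by (simp add: norm_projection S Q inner_projections)
  also have "real CARD('p) - (\<Sum>j\<in>UNIV. (norm (transpose Q *v column j S))\<^sup>2) =
      (\<Sum>j\<in>UNIV. (norm (column j S - Q *v (transpose Q *v column j S)))\<^sup>2)"
    by (simp add: norm_residual [OF Q] sum_subtractf column_eq_mult_axis orthonormal_cols_norm [OF S])
  finally show ?thesis .
qed

text \<open>The columns of V with index in I are completed to p orthonormal columns by vectors from the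
  range of Q that are orthogonal to them.\<close>

lemma orthonormal_completion:
  fixes V :: "real^'n^'n" and Q :: "real^'p^'n"
  assumes V: "orthogonal_matrix V" and Q: "orthonormal_cols Q" and card: "card I \<le> CARD('p)"
  obtains S :: "real^'p^'n" where "orthonormal_cols S" "\<And>i. i \<in> I \<Longrightarrow> column i V \<in> columns S"
    "card I = CARD('p) \<Longrightarrow> S ** transpose S = sub_cols V I ** transpose (sub_cols V I)"
    "(norm (Q ** transpose Q - S ** transpose S))\<^sup>2 =
      2 * (\<Sum>i\<in>I. (norm (column i V - Q *v (transpose Q *v column i V)))\<^sup>2)"
proof -
  obtain J :: "'p set" where J: "card J = card I"
    using obtain_subset_with_card_n [OF card] by blast
  then obtain g where g: "bij_betw g J I"
    using finite_same_card_bij [of J I] by auto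
  define A where "A = span ((\<lambda>i. transpose Q *v column i V) ` I)"
  define Y where "Y = {y \<in> UNIV. \<forall>x\<in>A. orthogonal x y}"
  have subY: "subspace Y"
    by (auto simp: Y_def subspace_def orthogonal_clauses)
  have "dim A \<le> card ((\<lambda>i. transpose Q *v column i V) ` I)"
    unfolding A_def by (rule dim_le_card) auto
  also have "\<dots> \<le> card I"
    by (rule card_image_le) simp
  finally have dimA: "dim A \<le> card I" .
  have "dim Y + dim A = dim (UNIV :: (real^'p) set)"
    unfolding Y_def by (rule dim_subspace_orthogonal_to_vectors) (auto simp: A_def)
  then have dimY: "CARD('p) - card I \<le> dim Y"
    using dimA by simp
  obtain E where E: "E \<subseteq> Y" "pairwise orthogonal E" "\<And>x. x \<in> E \<Longrightarrow> norm x = 1" "card E = dim Y"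
    using orthonormal_basis_subspace [OF subY] by metis
  obtain C where C: "C \<subseteq> E" "card C = CARD('p) - card I" "finite C"
    using obtain_subset_with_card_n [of "CARD('p) - card I" E] dimY E(4) by metis
  have "card (- J) = card C"
    using C J by (simp add: Compl_eq_Diff_UNIV card_Diff_subset)
  then obtain h where h: "bij_betw h (- J) C"
    using finite_same_card_bij [of "- J" C] C by auto
  define s where "s = (\<lambda>j. if j \<in> J then column (g j) V else Q *v h j)"
  define S where "S = (\<chi> a j. s j $ a)"
  have col: "column j S = s j" for j
    by (simp add: S_def column_def vec_eq_iff)
  have VV: "column i V \<bullet> column j V = (if i = j then 1 else 0)" for i j
    using orthogonal_matrix_cols [OF V] by (simp add: orthonormal_cols_iff)
  have VQ: "column (g i) V \<bullet> (Q *v h j) = 0" if "i \<in> J" "j \<notin> J" for i j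
  proof -
    have "g i \<in> I" "h j \<in> Y"
      using g h that C E by (auto simp: bij_betw_def)
    then have "orthogonal (transpose Q *v column (g i) V) (h j)"
      unfolding Y_def A_def by (auto intro: span_base)
    then show ?thesis
      by (simp add: orthogonal_def inner_matrix_vector_left)
  qed
  have QQ: "(Q *v h i) \<bullet> (Q *v h j) = (if i = j then 1 else 0)" if "i \<notin> J" "j \<notin> J" for i j
  proof -
    have "h i \<in> E" "h j \<in> E" "h i = h j \<longleftrightarrow> i = j"
      using h that C(1) by (auto simp: bij_betw_def inj_on_def)
    then show ?thesis
      using E(2) E(3) [of "h i"]
      by (auto simp: orthonormal_cols_inner [OF Q] pairwise_def orthogonal_def norm_eq_sqrt_inner)
  qed
  have inj: "g i = g j \<longleftrightarrow> i = j" if "i \<in> J" "j \<in> J" for i j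
    using g that by (auto simp: bij_betw_def inj_on_def)
  have "s i \<bullet> s j = (if i = j then 1 else 0)" for i j
    using VV VQ [of i j] VQ [of j i] QQ [of i j] inj [of i j] by (auto simp: s_def inner_commute)
  then have S: "orthonormal_cols S"
    by (simp add: orthonormal_cols_iff col)
  have *: "(\<Sum>j\<in>J. \<phi> (s j)) = (\<Sum>i\<in>I. \<phi> (column i V))" for \<phi> :: "real^'n \<Rightarrow> real"
    by (rule sum.reindex_bij_betw [OF g, of "\<lambda>i. \<phi> (column i V)", symmetric, THEN trans, symmetric])
      (simp add: s_def)
  show thesis
  proof (rule that [OF S])
    show "column i V \<in> columns S" if "i \<in> I" for i
    proof -
      obtain j where "j \<in> J" "g j = i"
        using g \<open>i \<in> I\<close> by (auto simp: bij_betw_def)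
      then have "column j S = column i V"
        by (simp add: col s_def)
      then show ?thesis
        unfolding columns_def by (metis (mono_tags) UNIV_I mem_Collect_eq)
    qed
    show "S ** transpose S = sub_cols V I ** transpose (sub_cols V I)" if "card I = CARD('p)"
    proof -
      have JU: "J = UNIV"
        using that J by (simp add: card_eq_UNIV_imp_eq_UNIV)
      have "(S ** transpose S) $ a $ b = (sub_cols V I ** transpose (sub_cols V I)) $ a $ b" for a b
      proof -
        have "(S ** transpose S) $ a $ b = (\<Sum>j\<in>J. s j $ a * s j $ b)"
          by (simp add: matrix_matrix_mult_def transpose_def S_def JU)
        also have "\<dots> = (\<Sum>i\<in>I. V $ a $ i * V $ b $ i)"
          using * [of "\<lambda>v. v $ a * v $ b"] by (simp add: column_def)
        also have "\<dots> = (\<Sum>i\<in>UNIV. if i \<in> I then V $ a $ i * V $ b $ i else 0)"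
          by (simp add: sum.If_cases)
        also have "\<dots> = (sub_cols V I ** transpose (sub_cols V I)) $ a $ b"
          by (auto simp: matrix_matrix_mult_def transpose_def sub_cols_def intro!: sum.cong)
        finally show ?thesis .
      qed
      then show ?thesis
        by (simp add: vec_eq_iff)
    qed
    let ?\<phi> = "\<lambda>v. (norm (v - Q *v (transpose Q *v v)))\<^sup>2"
    have "(\<Sum>j\<in>UNIV. ?\<phi> (s j)) = (\<Sum>j\<in>J. ?\<phi> (s j)) + (\<Sum>j\<in>-J. ?\<phi> (s j))"
      by (subst sum.union_disjoint [symmetric]) auto
    also have "(\<Sum>j\<in>-J. ?\<phi> (s j)) = 0"
      by (intro sum.neutral) (simp add: s_def orthonormal_cols_cancel [OF Q])
    finally have "(\<Sum>j\<in>UNIV. ?\<phi> (s j)) = (\<Sum>i\<in>I. ?\<phi> (column i V))"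
      using * [of ?\<phi>] by simp
    then show "(norm (Q ** transpose Q - S ** transpose S))\<^sup>2 = 2 * (\<Sum>i\<in>I. ?\<phi> (column i V))"
      using norm_diff_projections [OF S Q] by (simp add: col norm_minus_commute)
  qed
qed

lemma Proj_lipschitz:
  obtains C where "C \<ge> 0"
    "\<And>(S :: real^'p^'n) (Q :: real^'p^'n) X. orthonormal_cols S \<Longrightarrow> orthonormal_cols Q \<Longrightarrow>
      norm (Proj Q X - Proj S X) \<le> C * norm (Q ** transpose Q - S ** transpose S) * norm X"
proof -
  have "(A + B) ** C = A ** C + B ** C" for A B C :: "real^'n^'n"
    by (simp add: vec_eq_iff matrix_matrix_mult_def distrib_right sum.distrib)
  then have "bilinear ((**) :: real^'n^'n \<Rightarrow> real^'n^'n \<Rightarrow> real^'n^'n)"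
    unfolding bilinear_def
    by (auto intro!: linearI simp: matrix_add_ldistrib scalar_matrix_assoc matrix_scalar_ac)
  then have bb: "bounded_bilinear ((**) :: real^'n^'n \<Rightarrow> real^'n^'n \<Rightarrow> real^'n^'n)"
    by (simp add: bilinear_conv_bounded_bilinear)
  from bounded_bilinear.pos_bounded [OF bb] obtain K where
    "K > 0" and "\<forall>A :: real^'n^'n. \<forall>B :: real^'n^'n. norm (A ** B) \<le> norm A * norm B * K"
    by metis
  then have K: "K > 0" "norm (A ** B) \<le> norm A * norm B * K" for A B :: "real^'n^'n"
    by (blast, metis)
  define c where "c = sqrt (real CARD('p))"
  have bound: "norm (Proj Q X - Proj S X) \<le> 2 * K\<^sup>2 * c * norm (Q ** transpose Q - S ** transpose S) * norm X"
    if S: "orthonormal_cols S" and Q: "orthonormal_cols Q" for S Q :: "real^'p^'n" and X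
  proof -
    define P P' where "P = Q ** transpose Q" and "P' = S ** transpose S"
    have c: "norm P = c" "norm P' = c"
      unfolding c_def P_def P'_def
      by (rule real_sqrt_unique [symmetric]; simp add: norm_projection S Q)+
    have "Proj Q X - Proj S X = P ** X ** P - P' ** X ** P'"
      by (simp add: Proj_def P_def P'_def matrix_mul_assoc)
    also have "\<dots> = (P - P') ** X ** P + P' ** X ** (P - P')"
      by (simp add: bounded_bilinear.diff_left [OF bb] bounded_bilinear.diff_right [OF bb])
    finally have "norm (Proj Q X - Proj S X) \<le> norm ((P - P') ** X ** P) + norm (P' ** X ** (P - P'))"
      by (simp add: norm_triangle_ineq)
    also have "norm ((P - P') ** X ** P) \<le> (norm (P - P') * norm X * K) * norm P * K"
      using K(1) by (intro order_trans [OF K(2)] mult_right_mono K(2)) auto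
    also have "norm (P' ** X ** (P - P')) \<le> (norm P' * norm X * K) * norm (P - P') * K"
      using K(1) by (intro order_trans [OF K(2)] mult_right_mono K(2)) auto
    finally show ?thesis
      by (simp add: c algebra_simps power2_eq_square flip: P_def P'_def)
  qed
  show thesis
    by (rule that [OF _ bound]) (simp_all add: c_def)
qed

subsection \<open>The inexact proximal gradient method\<close>

lemma prox_inequality:
  fixes R :: "'a::real_inner \<Rightarrow> ereal"
  assumes \<tau>: "\<tau> > 0" and R: "ereal_convex R" and u: "is_prox \<tau> R y u" and z: "R z = ereal rz"
  obtains ru where "R u = ereal ru"
    "ru - rz \<le> 1 / (2 * \<tau>) * ((norm (z - y))\<^sup>2 - (norm (u - y))\<^sup>2 - (norm (z - u))\<^sup>2)"
proof -
  define c where "c = 1 / (2 * \<tau>)"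
  have c: "c \<ge> 0"
    using \<tau> by (simp add: c_def)
  have min: "R u + ereal (c * (norm (u - y))\<^sup>2) \<le> R w + ereal (c * (norm (w - y))\<^sup>2)" for w
    using u by (auto simp: is_prox_def is_arg_min_def c_def not_less)
  have "R u \<noteq> \<infinity>"
    using min [of z] z by auto
  moreover have "R u \<noteq> - \<infinity>"
    using R by (auto simp: ereal_convex_def)
  ultimately obtain ru where ru: "R u = ereal ru"
    by (cases "R u") auto
  define E D where "E = (norm (z - u))\<^sup>2" and "D = (norm (z - y))\<^sup>2 - (norm (u - y))\<^sup>2"
  have bound: "ru - rz - c * (D - E) \<le> t * (c * E)" if t: "0 < t" "t < 1" for t
  proof -
    define w where "w = (1 - t) *\<^sub>R u + t *\<^sub>R z"
    have "R w \<le> ereal (1 - t) * R u + ereal t * R z"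
      using R t by (auto simp: ereal_convex_def w_def)
    then have "R w \<le> ereal ((1 - t) * ru + t * rz)"
      by (simp add: ru z)
    then have "R u + ereal (c * (norm (u - y))\<^sup>2) \<le>
        ereal ((1 - t) * ru + t * rz) + ereal (c * (norm (w - y))\<^sup>2)"
      by (intro order_trans [OF min [of w]] add_right_mono)
    then have "ru + c * (norm (u - y))\<^sup>2 \<le> (1 - t) * ru + t * rz + c * (norm (w - y))\<^sup>2"
      by (simp add: ru)
    moreover have "(norm (w - y))\<^sup>2 = (norm (u - y))\<^sup>2 + t * (D - (1 - t) * E)"
    proof -
      have wy: "w - y = (1 - t) *\<^sub>R (u - y) + t *\<^sub>R (z - y)" and zu: "z - u = (z - y) - (u - y)"
        by (simp_all add: w_def algebra_simps)
      show ?thesis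
        unfolding D_def E_def wy zu power2_norm_eq_inner
        by (simp add: inner_add_left inner_add_right inner_diff_left inner_diff_right inner_commute
            algebra_simps)
    qed
    ultimately have "t * (ru - rz) \<le> t * (c * (D - (1 - t) * E))"
      by (simp add: algebra_simps)
    then have "ru - rz \<le> c * (D - (1 - t) * E)"
      using t by simp
    then show ?thesis
      by (simp add: algebra_simps)
  qed
  have "((\<lambda>t. t * (c * E)) \<longlongrightarrow> 0 * (c * E)) (at_right 0)"
    by (intro tendsto_intros)
  moreover have "eventually (\<lambda>t. ru - rz - c * (D - E) \<le> t * (c * E)) (at_right 0)"
    using eventually_at_right_real [OF zero_less_one]
    by eventually_elim (auto intro: bound)
  ultimately have "ru - rz - c * (D - E) \<le> 0 * (c * E)"
    by (rule tendsto_lowerbound) auto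
  then show thesis
    using that [OF ru] by (simp add: c_def D_def E_def)
qed

lemma GDERIV_line:
  fixes F :: "'a::real_inner \<Rightarrow> real"
  assumes F: "\<And>u. GDERIV F u :> gradF u"
  shows "((\<lambda>t. F (x + t *\<^sub>R v)) has_real_derivative (v \<bullet> gradF (x + t *\<^sub>R v))) (at t)"
proof -
  have "((\<lambda>t. x + t *\<^sub>R v) has_derivative (\<lambda>t. t *\<^sub>R v)) (at t)"
    by (auto intro!: derivative_eq_intros)
  moreover have "(F has_derivative (\<lambda>h. h \<bullet> gradF (x + t *\<^sub>R v))) (at (x + t *\<^sub>R v))"
    using F by (simp add: gderiv_def)
  ultimately have "((\<lambda>t. F (x + t *\<^sub>R v)) has_derivative (\<lambda>h. (h *\<^sub>R v) \<bullet> gradF (x + t *\<^sub>R v))) (at t)"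
    by (rule has_derivative_compose)
  then show ?thesis
    by (simp add: has_field_derivative_def mult_commute_abs)
qed

lemma lipschitz_gradient_upper_bound:
  fixes F :: "'a::real_inner \<Rightarrow> real"
  assumes F: "\<And>u. GDERIV F u :> gradF u" and L: "L-lipschitz_on UNIV gradF"
  shows "F y \<le> F x + gradF x \<bullet> (y - x) + L / 2 * (norm (y - x))\<^sup>2"
proof -
  define v where "v = y - x"
  define \<phi> where "\<phi> = (\<lambda>t. F (x + t *\<^sub>R v) - t * (gradF x \<bullet> v) - L / 2 * t\<^sup>2 * (norm v)\<^sup>2)"
  have "\<phi> 1 \<le> \<phi> 0"
  proof (rule DERIV_nonpos_imp_nonincreasing [where f = \<phi>])
    fix t :: real
    assume t: "0 \<le> t" "t \<le> 1"
    have "(\<phi> has_real_derivative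
        (v \<bullet> gradF (x + t *\<^sub>R v) - gradF x \<bullet> v - L * t * (norm v)\<^sup>2)) (at t)"
      unfolding \<phi>_def by (auto intro!: derivative_eq_intros GDERIV_line [OF F])
    moreover have "v \<bullet> gradF (x + t *\<^sub>R v) - gradF x \<bullet> v - L * t * (norm v)\<^sup>2 \<le> 0"
    proof -
      have "v \<bullet> gradF (x + t *\<^sub>R v) - gradF x \<bullet> v = v \<bullet> (gradF (x + t *\<^sub>R v) - gradF x)"
        by (simp add: inner_diff_right inner_commute)
      also have "\<dots> \<le> norm v * norm (gradF (x + t *\<^sub>R v) - gradF x)"
        by (rule norm_cauchy_schwarz)
      also have "\<dots> \<le> norm v * (L * norm (t *\<^sub>R v))"
        using lipschitz_onD [OF L, of "x + t *\<^sub>R v" x] by (intro mult_left_mono) (auto simp: dist_norm)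
      finally show ?thesis
        using t by (simp add: power2_eq_square mult_ac)
    qed
    ultimately show "\<exists>d. (\<phi> has_real_derivative d) (at t) \<and> d \<le> 0"
      by blast
  qed simp
  then show ?thesis
    by (simp add: \<phi>_def v_def)
qed

lemma convex_gradient_lower_bound:
  fixes F :: "'a::real_inner \<Rightarrow> real"
  assumes F: "\<And>u. GDERIV F u :> gradF u" and convex: "convex_on UNIV F"
  shows "F x + gradF x \<bullet> (y - x) \<le> F y"
proof -
  define \<phi> where "\<phi> = (\<lambda>t. F (x + t *\<^sub>R (y - x)))"
  have "convex_on UNIV \<phi>"
  proof (rule convex_onI)
    fix t a b :: real
    assume t: "0 < t" "t < 1"
    have "x + ((1 - t) *\<^sub>R a + t *\<^sub>R b) *\<^sub>R (y - x) =
        (1 - t) *\<^sub>R (x + a *\<^sub>R (y - x)) + t *\<^sub>R (x + b *\<^sub>R (y - x))"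
      by (simp add: algebra_simps)
    then show "\<phi> ((1 - t) *\<^sub>R a + t *\<^sub>R b) \<le> (1 - t) * \<phi> a + t * \<phi> b"
      unfolding \<phi>_def using convex_onD [OF convex, of t] t by simp
  qed simp
  moreover have "(\<phi> has_real_derivative ((y - x) \<bullet> gradF x)) (at 0)"
    using GDERIV_line [OF F, of x "y - x" 0] by (simp add: \<phi>_def)
  ultimately have "((y - x) \<bullet> gradF x) * (1 - 0) \<le> \<phi> 1 - \<phi> 0"
    by (intro convex_on_imp_above_tangent [of UNIV]) auto
  then show ?thesis
    by (simp add: \<phi>_def inner_commute)
qed

lemma inexact_prox_gradient_step:
  fixes F :: "'a::real_inner \<Rightarrow> real"
  assumes F: "\<And>u. GDERIV F u :> gradF u" "convex_on UNIV F" "L-lipschitz_on UNIV gradF"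
    and R: "ereal_convex R" and \<tau>: "0 < \<tau>" "\<tau> * L \<le> 1"
    and u: "is_prox \<tau> R (x - \<tau> *\<^sub>R g) u" and z: "R z = ereal rz"
  obtains ru where "R u = ereal ru"
    "F u + ru \<le> F z + rz + 1 / (2 * \<tau>) * ((norm (z - x))\<^sup>2 - (norm (z - u))\<^sup>2)
       + norm (g - gradF x) * norm (z - u)"
proof -
  obtain ru where ru: "R u = ereal ru" and
    prox: "ru - rz \<le> 1 / (2 * \<tau>) * ((norm (z - (x - \<tau> *\<^sub>R g)))\<^sup>2 - (norm (u - (x - \<tau> *\<^sub>R g)))\<^sup>2
        - (norm (z - u))\<^sup>2)"
    using prox_inequality [OF \<tau>(1) R u z] .
  have "(norm (z - (x - \<tau> *\<^sub>R g)))\<^sup>2 - (norm (u - (x - \<tau> *\<^sub>R g)))\<^sup>2 =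
      (norm (z - x))\<^sup>2 - (norm (u - x))\<^sup>2 + 2 * \<tau> * (g \<bullet> (z - u))"
    unfolding power2_norm_eq_inner
    by (simp add: inner_add_left inner_add_right inner_diff_left inner_diff_right inner_commute
        algebra_simps)
  moreover have "1 / (2 * \<tau>) * (A - B + 2 * \<tau> * q - E) =
      1 / (2 * \<tau>) * (A - E) - 1 / (2 * \<tau>) * B + q" for A B q E :: real
    using \<tau>(1) by (simp add: field_simps)
  ultimately have "ru - rz \<le> 1 / (2 * \<tau>) * ((norm (z - x))\<^sup>2 - (norm (z - u))\<^sup>2)
      - 1 / (2 * \<tau>) * (norm (u - x))\<^sup>2 + g \<bullet> (z - u)"
    using prox by (simp only:)
  moreover have "F u \<le> F x + gradF x \<bullet> (u - x) + L / 2 * (norm (u - x))\<^sup>2"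
    by (rule lipschitz_gradient_upper_bound [OF F(1,3)])
  moreover have "F x + gradF x \<bullet> (z - x) \<le> F z"
    by (rule convex_gradient_lower_bound [OF F(1,2)])
  moreover have "L / 2 * (norm (u - x))\<^sup>2 \<le> 1 / (2 * \<tau>) * (norm (u - x))\<^sup>2"
    using \<tau> by (intro mult_right_mono) (auto simp: field_simps)
  moreover have "gradF x \<bullet> (u - x) - gradF x \<bullet> (z - x) + g \<bullet> (z - u) = (g - gradF x) \<bullet> (z - u)"
    by (simp add: inner_diff_left inner_diff_right)
  moreover have "(g - gradF x) \<bullet> (z - u) \<le> norm (g - gradF x) * norm (z - u)"
    by (rule norm_cauchy_schwarz)
  ultimately have "F u + ru \<le> F z + rz + 1 / (2 * \<tau>) * ((norm (z - x))\<^sup>2 - (norm (z - u))\<^sup>2)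
       + norm (g - gradF x) * norm (z - u)"
    by linarith
  then show thesis
    using that [OF ru] by blast
qed

lemma cesaro_mean_zero:
  fixes e :: "nat \<Rightarrow> real"
  assumes "e \<longlonglongrightarrow> 0"
  shows "(\<lambda>K. (1 / real K) * (\<Sum>k<K. e k)) \<longlonglongrightarrow> 0"
proof (rule tendstoI)
  fix \<epsilon> :: real
  assume \<epsilon>: "\<epsilon> > 0"
  then obtain N where N: "\<And>k. k \<ge> N \<Longrightarrow> \<bar>e k\<bar> < \<epsilon> / 2"
    using LIMSEQ_D [OF assms, of "\<epsilon> / 2"] by auto
  define C where "C = (\<Sum>k<N. \<bar>e k\<bar>)"
  have "(\<lambda>K. C / real K) \<longlonglongrightarrow> 0"
    by (rule lim_const_over_n)
  then have "eventually (\<lambda>K. C / real K < \<epsilon> / 2) sequentially"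
    using \<epsilon> by (intro order_tendstoD(2)) auto
  then show "eventually (\<lambda>K. dist ((1 / real K) * (\<Sum>k<K. e k)) 0 < \<epsilon>) sequentially"
    using eventually_ge_at_top [of N] eventually_gt_at_top [of 0]
  proof eventually_elim
    case (elim K)
    have "\<bar>\<Sum>k<K. e k\<bar> \<le> (\<Sum>k<K. \<bar>e k\<bar>)"
      by (rule sum_abs)
    also have "\<dots> = C + (\<Sum>k=N..<K. \<bar>e k\<bar>)"
      using elim unfolding C_def lessThan_atLeast0 by (subst sum.atLeastLessThan_concat) auto
    also have "(\<Sum>k=N..<K. \<bar>e k\<bar>) \<le> (\<Sum>k=N..<K. \<epsilon> / 2)"
      using N by (intro sum_mono) (auto intro: less_imp_le)
    also have "\<dots> \<le> real K * (\<epsilon> / 2)"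
      using \<epsilon> by (auto intro!: mult_right_mono)
    finally have "\<bar>\<Sum>k<K. e k\<bar> / real K \<le> C / real K + \<epsilon> / 2"
      using elim by (simp add: field_simps)
    then have "\<bar>\<Sum>k<K. e k\<bar> / real K < \<epsilon>"
      using elim(1) by linarith
    then show ?case
      by (simp add: abs_mult)
  qed
qed

lemma inexact_prox_gradient_converges:
  fixes F :: "'a::real_inner \<Rightarrow> real"
  assumes F: "\<And>u. GDERIV F u :> gradF u" "convex_on UNIV F" "L-lipschitz_on UNIV gradF"
    and R: "ereal_convex R" and \<tau>: "0 < \<tau>" "\<tau> * L \<le> 1"
    and x: "\<And>k. is_prox \<tau> R (x k - \<tau> *\<^sub>R g k) (x (Suc k))"
    and error: "(\<lambda>k. g k - gradF (x k)) \<longlonglongrightarrow> 0"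
    and bounded: "\<And>k. norm (x k) \<le> M"
    and h: "h = (\<lambda>u. ereal (F u) + R u)" and opt: "is_arg_min h (\<lambda>_. True) xs"
  shows "(\<lambda>K. h ((1 / real K) *\<^sub>R (\<Sum>k=1..K. x k))) \<longlonglongrightarrow> h xs"
proof (cases "R xs")
  case MInf
  then show ?thesis
    using R by (auto simp: ereal_convex_def)
next
  case PInf
  then have "h y = \<infinity>" for y
    using opt by (auto simp: h is_arg_min_def)
  then show ?thesis
    by simp
next
  case (real rs)
  have min: "h xs \<le> h y" for y
    using opt by (auto simp: is_arg_min_def not_less)
  define r where "r = (\<lambda>u. real_of_ereal (R u))"
  define hs where "hs = F xs + rs"
  define e where "e = (\<lambda>k. norm (g k - gradF (x k)) * (norm xs + M))"
  have step: "R (x (Suc k)) = ereal (r (x (Suc k))) \<and> F (x (Suc k)) + r (x (Suc k)) \<le>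
      hs + 1 / (2 * \<tau>) * ((norm (xs - x k))\<^sup>2 - (norm (xs - x (Suc k)))\<^sup>2) + e k" for k
  proof -
    obtain ru where ru: "R (x (Suc k)) = ereal ru"
      "F (x (Suc k)) + ru \<le> F xs + rs + 1 / (2 * \<tau>) * ((norm (xs - x k))\<^sup>2 - (norm (xs - x (Suc k)))\<^sup>2)
       + norm (g k - gradF (x k)) * norm (xs - x (Suc k))"
      using inexact_prox_gradient_step [OF F R \<tau> x real] .
    have "norm (xs - x (Suc k)) \<le> norm xs + M"
      using norm_triangle_ineq4 [of xs "x (Suc k)"] bounded [of "Suc k"] by linarith
    then have "norm (g k - gradF (x k)) * norm (xs - x (Suc k)) \<le> e k"
      unfolding e_def by (intro mult_left_mono) auto
    then show ?thesis
      using ru by (simp add: r_def hs_def)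
  qed
  define D where "D = {u. R u < \<infinity>}"
  have rD: "R u = ereal (r u)" if "u \<in> D" for u
    using that R by (cases "R u") (auto simp: D_def r_def ereal_convex_def)
  have R_conv: "R ((1 - t) *\<^sub>R u + t *\<^sub>R v) \<le> ereal ((1 - t) * r u + t * r v)"
    if "u \<in> D" "v \<in> D" "0 \<le> t" "t \<le> 1" for u v t
  proof -
    have "R ((1 - t) *\<^sub>R u + t *\<^sub>R v) \<le> ereal (1 - t) * R u + ereal t * R v"
      using R that by (auto simp: ereal_convex_def)
    then show ?thesis
      by (simp add: rD that)
  qed
  have "convex D"
    unfolding convex_alt
  proof (intro ballI allI impI)
    fix u v and t :: real
    assume "u \<in> D" "v \<in> D" "0 \<le> t \<and> t \<le> 1"
    then show "(1 - t) *\<^sub>R u + t *\<^sub>R v \<in> D"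
      using R_conv [of u v t] by (auto simp: D_def intro: le_less_trans)
  qed
  have r_conv: "convex_on D r"
  proof (rule convex_onI [OF _ \<open>convex D\<close>])
    fix t :: real and u v
    assume "0 < t" "t < 1" "u \<in> D" "v \<in> D"
    moreover from this have "(1 - t) *\<^sub>R u + t *\<^sub>R v \<in> D"
      using convexD_alt [OF \<open>convex D\<close>] by auto
    ultimately show "r ((1 - t) *\<^sub>R u + t *\<^sub>R v) \<le> (1 - t) * r u + t * r v"
      using R_conv [of u v t] rD by auto
  qed
  define ub where "ub = (\<lambda>K. hs + (1 / real K) * ((norm (xs - x 0))\<^sup>2 / (2 * \<tau>)) + (1 / real K) * (\<Sum>k<K. e k))"
  have upper: "h ((1 / real K) *\<^sub>R (\<Sum>k=1..K. x k)) \<le> ereal (ub K)" if K: "K > 0" for K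
  proof -
    define X where "X = (\<Sum>k=1..K. (1 / real K) *\<^sub>R x k)"
    have xD: "x k \<in> D" if "k \<in> {1..K}" for k
      using step [of "k - 1"] that by (auto simp: D_def)
    have wsum: "(\<Sum>k=1..K. 1 / real K) = 1"
      using K by simp
    have XD: "X \<in> D"
      unfolding X_def using wsum xD by (intro convex_sum [OF _ \<open>convex D\<close>]) auto
    have "r X \<le> (\<Sum>k=1..K. (1 / real K) * r (x k))"
      unfolding X_def using wsum xD K by (intro convex_on_sum [OF _ _ r_conv]) auto
    moreover have "F X \<le> (\<Sum>k=1..K. (1 / real K) * F (x k))"
      unfolding X_def using wsum K by (intro convex_on_sum [OF _ _ F(2)]) auto
    ultimately have "F X + r X \<le> (1 / real K) * (\<Sum>k=1..K. F (x k) + r (x k))"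
      by (simp add: sum_distrib_left sum.distrib distrib_left add_divide_distrib)
    also have "(\<Sum>k=1..K. F (x k) + r (x k)) = (\<Sum>k<K. F (x (Suc k)) + r (x (Suc k)))"
      by (simp add: sum.atLeast1_atMost_eq)
    also have "(1 / real K) * \<dots> \<le> (1 / real K) *
        (\<Sum>k<K. hs + 1 / (2 * \<tau>) * ((norm (xs - x k))\<^sup>2 - (norm (xs - x (Suc k)))\<^sup>2) + e k)"
      using step by (intro mult_left_mono sum_mono) auto
    also have "(\<Sum>k<K. hs + 1 / (2 * \<tau>) * ((norm (xs - x k))\<^sup>2 - (norm (xs - x (Suc k)))\<^sup>2) + e k) =
        real K * hs + 1 / (2 * \<tau>) * ((norm (xs - x 0))\<^sup>2 - (norm (xs - x K))\<^sup>2) + (\<Sum>k<K. e k)"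
      using sum_lessThan_telescope' [of "\<lambda>k. (norm (xs - x k))\<^sup>2" K]
      by (simp only: sum.distrib flip: sum_distrib_left) simp
    also have "(1 / real K) * \<dots> \<le>
        (1 / real K) * (real K * hs + (norm (xs - x 0))\<^sup>2 / (2 * \<tau>) + (\<Sum>k<K. e k))"
      using \<tau> by (intro mult_left_mono) (auto simp: field_simps)
    also have "\<dots> = ub K"
      using K by (simp add: ub_def distrib_left)
    finally have "F X + r X \<le> ub K" .
    moreover have "X = (1 / real K) *\<^sub>R (\<Sum>k=1..K. x k)"
      by (simp add: X_def scaleR_sum_right)
    ultimately show ?thesis
      using rD [OF XD] by (simp add: h)
  qed
  have "ub \<longlonglongrightarrow> hs + 0 * ((norm (xs - x 0))\<^sup>2 / (2 * \<tau>)) + 0"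
    unfolding ub_def
  proof (intro tendsto_add tendsto_mult tendsto_const cesaro_mean_zero lim_const_over_n)
    have "(\<lambda>k. norm (g k - gradF (x k)) * (norm xs + M)) \<longlonglongrightarrow> 0 * (norm xs + M)"
      by (intro tendsto_mult tendsto_const tendsto_norm_zero error)
    then show "e \<longlonglongrightarrow> 0"
      by (simp add: e_def)
  qed
  then have lim: "(\<lambda>K. ereal (ub K)) \<longlonglongrightarrow> h xs"
    by (simp add: h hs_def real)
  have "eventually (\<lambda>K. h xs \<le> h ((1 / real K) *\<^sub>R (\<Sum>k=1..K. x k))) sequentially"
    by (simp add: min)
  moreover have "eventually (\<lambda>K. h ((1 / real K) *\<^sub>R (\<Sum>k=1..K. x k)) \<le> ereal (ub K)) sequentially"
    using eventually_gt_at_top [of 0] by eventually_elim (rule upper)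
  ultimately show ?thesis
    using tendsto_const lim by (rule tendsto_sandwich)
qed

theorem theorem3p4:
  fixes G :: "real^'n::{finite,linorder}^'n::{finite,linorder}"
    and Astar :: "real^'m \<Rightarrow> real^'n::{finite,linorder}^'n::{finite,linorder}"
    and B :: "real^'m \<Rightarrow> real^'n::{finite,linorder}^'n::{finite,linorder}"
    and f :: "real^'n::{finite,linorder} \<Rightarrow> real"
    and gradf :: "real^'n::{finite,linorder} \<Rightarrow> real^'n::{finite,linorder}"
    and F :: "real^'m \<Rightarrow> real" and gradF :: "real^'m \<Rightarrow> real^'m"
    and R h :: "real^'m \<Rightarrow> ereal"
    and \<Phi> :: "real^'n::{finite,linorder}^'n::{finite,linorder}
            \<Rightarrow> real^'n::{finite,linorder}^'n::{finite,linorder}"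
    and V :: "real^'m \<Rightarrow> real^'n::{finite,linorder}^'n::{finite,linorder}"
    and I :: "real^'m \<Rightarrow> 'n::{finite,linorder} set"
    and x :: "nat \<Rightarrow> real^'m"
    and U :: "nat \<Rightarrow> real^'p::{finite,linorder}^'n::{finite,linorder}"
    and a b :: "nat \<Rightarrow> real" and d q :: "nat \<Rightarrow> nat"
    and L L\<Phi> \<tau> \<gamma> M l :: real
    and xs :: "real^'m"
  \<comment> \<open>the problem\<close>
  assumes G_sym: "transpose G = G"
    and Astar: "linear Astar" "\<And>u. transpose (Astar u) = Astar u"
    and B: "B = (\<lambda>u. G + Astar u)"
    and f_smooth: "\<And>y. GDERIV f y :> gradf y" "continuous_on UNIV gradf"
    and f_sym: "\<And>\<pi> y. \<pi> permutes (UNIV :: 'n::{finite,linorder} set) \<Longrightarrow> f (\<chi> i. y $ \<pi> i) = f y"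
    and F: "F = (\<lambda>u. f (eigvals (B u)))"
    and h: "h = (\<lambda>u. ereal (F u) + R u)"
    and F_convex: "convex_on UNIV F"
    and R_convex: "ereal_convex R"
    and gradF: "\<And>u. GDERIV F u :> gradF u"
    and L: "L > 0" "L-lipschitz_on UNIV gradF"
  \<comment> \<open>Assumption A\<close>
    and V: "\<And>u. eigen_decomp (B u) (V u) (eigvals (B u))"
    and A_index: "\<And>u. \<exists>s t. I u = {s..t}"
    and A_grad: "\<And>u. gradF u = adjoint Astar (\<Phi> (Proj (sub_cols (V u) (I u)) (B u)))"
    and A_spectral: "spectral_operator \<Phi>"
    and A_lipschitz: "\<And>X Y. transpose X = X \<Longrightarrow> transpose Y = Y \<Longrightarrow>
                        norm (\<Phi> X - \<Phi> Y) \<le> L\<Phi> * norm (X - Y)"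
  \<comment> \<open>the PFPG iteration\<close>
    and step: "0 < \<tau>" "\<tau> \<le> 1 / L"
    and U0: "orthonormal_cols (U 0)"
    and x_iter: "\<And>k. is_prox \<tau> R (x k - \<tau> *\<^sub>R adjoint Astar (\<Phi> (Proj (U k) (B (x k))))) (x (Suc k))"
    and U_iter: "\<And>k. is_orth (U (Suc k))
                   (poly_mat (cheb_filter (d (Suc k)) (a (Suc k)) (b (Suc k)) ^ q (Suc k))
                      (B (x (Suc k))) ** U k)"
    and q: "\<And>k. q k \<ge> 1"
    and ab: "\<And>k. a k < b k"
    and I_outside: "\<And>k. I (x k) = {i. eigvals (B (x k)) $ i \<notin> {a k..b k}}"
    and p_ge: "\<And>k. card (I (x k)) \<le> CARD('p::{finite,linorder})"
  \<comment> \<open>only when U has more columns than the eigenvector matrix: columns added to a full set of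
      wanted eigenvectors do not change the reduced gradient\<close>
    and surplus: "\<And>k (S :: real^'p::{finite,linorder}^'n::{finite,linorder}).
                    card (I (x k)) < CARD('p::{finite,linorder}) \<Longrightarrow> orthonormal_cols S \<Longrightarrow>
                    (\<forall>i\<in>I (x k). column i (V (x k)) \<in> span (columns S)) \<Longrightarrow>
                    adjoint Astar (\<Phi> (Proj S (B (x k)))) = gradF (x k)"
  \<comment> \<open>Assumption B\<close>
    and B_angle: "\<gamma> < 1"
      "\<And>k. spectral_norm (sin_mat (Theta (V (x (Suc k))) (I (x (Suc k))) (U k))) < \<gamma>"
    and B_bounded: "\<And>k. norm (x k) \<le> M"
    and B_gap: "l > 0" "\<And>k. rel_gap (eigvals (B (x k))) (I (x k)) (a k) (b k) \<ge> ereal l"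
  \<comment> \<open>an optimal solution, and the condition on the filter degrees\<close>
    and opt: "is_arg_min h (\<lambda>_. True) xs"
    and degree: "(\<lambda>k. real (d k)) \<in> \<Omega>(\<lambda>k. ln (real k) / min l 1)"
  shows "(\<lambda>K. h ((1 / real K) *\<^sub>R (\<Sum>k=1..K. x k))) \<longlonglongrightarrow> h xs"
proof -
  define g where "g = (\<lambda>k. adjoint Astar (\<Phi> (Proj (U k) (B (x k)))))"
  define T where "T = (\<lambda>k. 1 + real (d k) * l)"
  define w where "w = sqrt (1 - \<gamma>\<^sup>2)"
  have oV: "orthogonal_matrix (V u)"
    and decomp: "B u = V u ** Diag (eigvals (B u)) ** transpose (V u)" for u
    using V [of u] by (auto simp: eigen_decomp_def)
  have symB: "transpose (B u) = B u" for u
    using G_sym Astar(2) [of u] by (simp add: B vec_eq_iff transpose_def)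
  have oU: "orthonormal_cols (U k)" for k
    using U0 U_iter by (cases k) (auto simp: is_orth_def)
  have \<gamma>0: "0 \<le> \<gamma>"
    using B_angle(2) [of 0] spectral_norm_nonneg order_less_imp_le order_trans by meson
  then have w: "w > 0"
    using B_angle(1) by (simp add: w_def power_less_one_iff)
  have T1: "1 \<le> T k" for k
    using B_gap(1) by (simp add: T_def)
  have residual: "norm (column i (V (x (Suc k))) - U (Suc k) *v (transpose (U (Suc k)) *v column i (V (x (Suc k)))))
      \<le> 1 / (T (Suc k) * w)" if i: "i \<in> I (x (Suc k))" for i k
    unfolding w_def
  proof (rule filter_approximation [OF oV oU p_ge B_angle(2) \<gamma>0 B_angle(1) _ _ _ _ i])
    let ?p = "cheb_filter (d (Suc k)) (a (Suc k)) (b (Suc k))"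
    let ?l = "eigvals (B (x (Suc k)))"
    show "is_orth (U (Suc k)) (poly_mat (?p ^ q (Suc k))
        (V (x (Suc k)) ** Diag ?l ** transpose (V (x (Suc k)))) ** U k)"
      using U_iter [of k] decomp [of "x (Suc k)"] by simp
    show "T (Suc k) \<le> \<bar>poly (?p ^ q (Suc k)) (?l $ j)\<bar>" if j: "j \<in> I (x (Suc k))" for j
    proof -
      have "ereal l \<le> ereal (\<bar>?l $ j - (a (Suc k) + b (Suc k)) / 2\<bar> / ((b (Suc k) - a (Suc k)) / 2) - 1)"
        using B_gap(2) [of "Suc k"] unfolding rel_gap_def by (rule order_trans) (rule INF_lower [OF j])
      then have "T (Suc k) \<le> \<bar>poly ?p (?l $ j)\<bar>"
        unfolding T_def using B_gap(1) by (intro abs_cheb_filter_ge_linear ab) auto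
      also have "\<dots> \<le> \<bar>poly ?p (?l $ j)\<bar> ^ q (Suc k)"
        using q [of "Suc k"] T1 [of "Suc k"] calculation by (intro self_le_power) auto
      finally show ?thesis
        by (simp add: power_abs)
    qed
    show "\<bar>poly (?p ^ q (Suc k)) (?l $ j)\<bar> \<le> 1" if j: "j \<notin> I (x (Suc k))" for j
    proof -
      have "\<bar>poly ?p (?l $ j)\<bar> \<le> 1"
        using j I_outside [of "Suc k"] by (intro abs_cheb_filter_le_1 ab) auto
      then show ?thesis
        by (simp add: power_abs power_le_one)
    qed
    show "0 < T (Suc k)"
      using T1 [of "Suc k"] by simp
  qed
  obtain C where C: "C \<ge> 0" "\<And>(S :: real^'p::{finite,linorder}^'n::{finite,linorder})
        (Q :: real^'p::{finite,linorder}^'n::{finite,linorder}) X.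
      orthonormal_cols S \<Longrightarrow> orthonormal_cols Q \<Longrightarrow>
      norm (Proj Q X - Proj S X) \<le> C * norm (Q ** transpose Q - S ** transpose S) * norm X"
    using Proj_lipschitz by blast
  have lin: "linear (adjoint Astar)"
    by (rule adjoint_linear [OF Astar(1)])
  obtain K1 where K1: "K1 > 0" "\<And>X. norm (adjoint Astar X) \<le> K1 * norm X"
    using linear_bounded_pos [OF lin] by blast
  obtain K2 where K2: "K2 > 0" "\<And>u. norm (Astar u) \<le> K2 * norm u"
    using linear_bounded_pos [OF Astar(1)] by blast
  define N where "N = norm G + K2 * M"
  have normB: "norm (B (x k)) \<le> N" for k
  proof -
    have "norm (B (x k)) \<le> norm G + norm (Astar (x k))"
      unfolding B by (rule norm_triangle_ineq)
    also have "\<dots> \<le> norm G + K2 * norm (x k)"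
      by (intro add_left_mono K2)
    also have "\<dots> \<le> N"
      unfolding N_def using K2(1) B_bounded by (intro add_left_mono mult_left_mono) auto
    finally show ?thesis .
  qed
  define n where "n = sqrt (2 * real CARD('n::{finite,linorder}))"
  define E where "E = K1 * (\<bar>L\<Phi>\<bar> * (C * n * N)) / w"
  have error: "norm (g (Suc k) - gradF (x (Suc k))) \<le> E / T (Suc k)" for k
  proof -
    let ?V = "V (x (Suc k))" and ?I = "I (x (Suc k))" and ?B = "B (x (Suc k))"
    let ?U = "U (Suc k)" and ?e = "1 / (T (Suc k) * w)"
    obtain S :: "real^'p::{finite,linorder}^'n::{finite,linorder}" where
      S: "orthonormal_cols S" "\<And>i. i \<in> ?I \<Longrightarrow> column i ?V \<in> columns S"
      "card ?I = CARD('p::{finite,linorder}) \<Longrightarrow> S ** transpose S = sub_cols ?V ?I ** transpose (sub_cols ?V ?I)"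
      "(norm (?U ** transpose ?U - S ** transpose S))\<^sup>2 =
        2 * (\<Sum>i\<in>?I. (norm (column i ?V - ?U *v (transpose ?U *v column i ?V)))\<^sup>2)"
      by (rule orthonormal_completion [OF oV [of "x (Suc k)"] oU [of "Suc k"] p_ge [of "Suc k"]])
        (rule that)
    have e: "0 \<le> ?e"
      using w T1 [of "Suc k"] by simp
    have "(norm (?U ** transpose ?U - S ** transpose S))\<^sup>2 \<le> 2 * (\<Sum>i\<in>?I. ?e\<^sup>2)"
      unfolding S(4) by (intro mult_left_mono sum_mono power_mono residual) auto
    also have "\<dots> \<le> 2 * real CARD('n::{finite,linorder}) * ?e\<^sup>2"
      by (simp add: mult_right_mono card_mono)
    also have "\<dots> = (n * ?e)\<^sup>2"
      by (simp only: n_def power_mult_distrib real_sqrt_pow2 mult_nonneg_nonneg of_nat_0_le_iff zero_le_numeral)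
    finally have near: "norm (?U ** transpose ?U - S ** transpose S) \<le> n * ?e"
      by (rule power2_le_imp_le) (use e in \<open>simp add: n_def\<close>)
    have grad: "gradF (x (Suc k)) = adjoint Astar (\<Phi> (Proj S ?B))"
    proof (cases "card ?I = CARD('p::{finite,linorder})")
      case True
      have "Proj S ?B = Proj (sub_cols ?V ?I) ?B"
        unfolding Proj_def matrix_mul_assoc [symmetric] S(3) [OF True, symmetric]
        by (simp only: matrix_mul_assoc S(3) [OF True])
      then show ?thesis
        by (simp only: A_grad)
    next
      case False
      then have "card ?I < CARD('p::{finite,linorder})"
        using p_ge [of "Suc k"] by simp
      then show ?thesis
        using surplus [OF _ S(1)] S(2) by (metis span_base)
    qed
    have symP: "transpose (Proj Q ?B) = Proj Q ?B" for Q :: "real^'p::{finite,linorder}^'n::{finite,linorder}"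
      by (simp add: Proj_def matrix_transpose_mul symB matrix_mul_assoc)
    have "norm (g (Suc k) - gradF (x (Suc k))) = norm (adjoint Astar (\<Phi> (Proj ?U ?B) - \<Phi> (Proj S ?B)))"
      by (simp add: g_def grad linear_diff [OF lin])
    also have "\<dots> \<le> K1 * norm (\<Phi> (Proj ?U ?B) - \<Phi> (Proj S ?B))"
      by (rule K1)
    also have "\<dots> \<le> K1 * (\<bar>L\<Phi>\<bar> * norm (Proj ?U ?B - Proj S ?B))"
    proof (rule mult_left_mono)
      have "norm (\<Phi> (Proj ?U ?B) - \<Phi> (Proj S ?B)) \<le> L\<Phi> * norm (Proj ?U ?B - Proj S ?B)"
        by (rule A_lipschitz [OF symP symP])
      also have "\<dots> \<le> \<bar>L\<Phi>\<bar> * norm (Proj ?U ?B - Proj S ?B)"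
        by (intro mult_right_mono) auto
      finally show "norm (\<Phi> (Proj ?U ?B) - \<Phi> (Proj S ?B)) \<le> \<bar>L\<Phi>\<bar> * norm (Proj ?U ?B - Proj S ?B)" .
    qed (use K1 in simp)
    also have "\<dots> \<le> K1 * (\<bar>L\<Phi>\<bar> * (C * (n * ?e) * N))"
    proof (intro mult_left_mono)
      have "norm (Proj ?U ?B - Proj S ?B) \<le> C * norm (?U ** transpose ?U - S ** transpose S) * norm ?B"
        by (rule C(2) [OF S(1) oU])
      also have "\<dots> \<le> C * (n * ?e) * N"
        using C(1) e by (intro mult_mono near normB mult_nonneg_nonneg) (auto simp: n_def)
      finally show "norm (Proj ?U ?B - Proj S ?B) \<le> C * (n * ?e) * N" .
    qed (use K1 in auto)
    also have "\<dots> = E / T (Suc k)"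
      by (simp add: E_def)
    finally show ?thesis .
  qed
  have "filterlim (\<lambda>k. real (d k)) at_top sequentially"
  proof -
    obtain c where c: "c > 0"
      "eventually (\<lambda>k. norm (real (d k)) \<ge> c * norm (ln (real k) / min l 1)) sequentially"
      using landau_omega.bigE [OF degree] by blast
    have "filterlim (\<lambda>k. c / min l 1 * ln (real k)) at_top sequentially"
      using c(1) B_gap(1)
      by (intro filterlim_tendsto_pos_mult_at_top [OF tendsto_const]
          filterlim_compose [OF ln_at_top filterlim_real_sequentially]) auto
    then show ?thesis
    proof (rule filterlim_at_top_mono)
      show "eventually (\<lambda>k. c / min l 1 * ln (real k) \<le> real (d k)) sequentially"
        using c(2) eventually_ge_at_top [of 1]
      proof eventually_elim
        case (elim k)
        then show ?case
          using B_gap(1) by (simp add: min_def split: if_splits)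
      qed
    qed
  qed
  then have "filterlim (\<lambda>k. real (d k) * l) at_top sequentially"
    using B_gap(1) by (intro filterlim_at_top_mult_tendsto_pos [OF tendsto_const])
  then have "filterlim T at_top sequentially"
    unfolding T_def by (intro filterlim_tendsto_add_at_top [OF tendsto_const])
  then have "(\<lambda>k. E / T k) \<longlonglongrightarrow> 0"
    by (intro tendsto_divide_0 [OF tendsto_const] filterlim_at_top_imp_at_infinity)
  then have "(\<lambda>k. E / T (Suc k)) \<longlonglongrightarrow> 0"
    by (rule LIMSEQ_Suc)
  then have "(\<lambda>k. g (Suc k) - gradF (x (Suc k))) \<longlonglongrightarrow> 0"
    by (rule Lim_null_comparison [rotated]) (simp add: error)
  then have "(\<lambda>k. g k - gradF (x k)) \<longlonglongrightarrow> 0"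
    by (simp only: filterlim_sequentially_Suc [of "\<lambda>k. g k - gradF (x k)"])
  moreover have "\<tau> * L \<le> 1"
    using step(2) L(1) by (simp add: field_simps)
  moreover have "is_prox \<tau> R (x k - \<tau> *\<^sub>R g k) (x (Suc k))" for k
    using x_iter by (simp add: g_def)
  ultimately show ?thesis
    by (intro inexact_prox_gradient_converges [OF gradF F_convex L(2) R_convex step(1) _ _ _ B_bounded h opt])
qed

end
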